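(* Let $M$ be a proper metric space and assume that $\mathsf\Delta^\circ_\omega=\mathfrak c$. For each separable $M$-soft compactification $K$ with set $K'$ of isolated points, there exists a cellular finitary coarse structure $\mathcal E$ on $K'$ such that $K$ is $M$-equivalent to the $M$-compactification $h_M(K',\mathcal E)$.
   Context: An entourage on a set $X$ is a subset $E\subseteq X\times X$ containing the diagonal $\Delta_X$; $E^{-1}=\{(y,x):(x,y)\in E\}$, $E\circ F=\{(x,z):\exists y\in X,\ (x,y)\in E,\ (y,z)\in F\}$, $E[x]=\{y\in X:(x,y)\in E\}$. A coarse space $(X,\mathcal E)$ is a set $X$ with a family $\mathcal E$ of entourages (its coarse structure) such that $\bigcup\mathcal E=X\times X$; for all $E,F\in\mathcal E$ there is $G\in\mathcal E$ with $E\circ F^{-1}\subseteq G$; and $\Delta_X\subseteq E\subseteq F\in\mathcal E$ implies $E\in\mathcal E$. A base of $\mathcal E$ is a subfamily $\mathcal B\subseteq\mathcal E$ such that each $E\in\mathcal E$ is contained in some $B\in\mathcal B$. A set $B\subseteq X$ is bounded if $B\subseteq E[x]$ for some $E\in\mathcal E$, $x\in X$. The coarse space is finitary if $\sup_{x\in X}|E[x]|$ is finite for every $E\in\mathcal E$, and cellular if $\mathcal E$ has a base consisting of equivalence relations. A subset $D\subseteq X$ is $\mathcal E$-discrete if for any $E\in\mathcal E$ there is a bounded set $B\subseteq X$ such that $D\cap E[x]=\{x\}$ for every $x\in D\setminus B$. $\mathsf\Delta^\circ_\omega$ is the smallest cardinality of a base of a cellular finitary coarse structure $\mathcal E$ on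 $\omega$ such that $\omega$ contains no infinite $\mathcal E$-discrete subsets; $\mathfrak c$ is the cardinality of the continuum. A metric space $(M,d_M)$ is proper if $|M|\ge 2$ and each closed bounded set in $M$ is compact. A function $\varphi:X\to M$ is slowly oscillating if for every $\varepsilon>0$ and $E\in\mathcal E$ there is a bounded set $B\subseteq X$ with $\mathrm{diam}\,\varphi(E[x])<\varepsilon$ for all $x\in X\setminus B$. Let $\mathsf{so}(X,\mathcal E;M)$ be the set of all bounded slowly oscillating functions $X\to M$. The $M$-compactification $h_M(X,\mathcal E)$ is the closure of the image of the injective map $X\to M^{\mathsf{so}(X,\mathcal E;M)}$, $x\mapsto(f(x))_f$ (product topology); it is compact Hausdorff. $X$ is identified with its image, and it is then the set of isolated points of $h_M(X,\mathcal E)$. A compactification is a compact Hausdorff space $K$ whose set $K'$ of isolated points is dense in $K$. Two compactifications $K_1,K_2$ with the same set $X=K_1'=K_2'$ of isolated points are $M$-equivalent if $\mathsf{uc}(X,K_1;M)=\mathsf{uc}(X,K_2;M)$, where $\mathsf{uc}(X,K;M)=\{f{\restriction}X: f:K\to M\text{ continuous}\}$. $\mathcal H(K,K')$ is the group of homeomorphisms $g$ of $K$ with $g(x)=x$ for all $x\in K\setminus K'$. For $\varphi:K'\to M$ and $z\in K$, $\mathrm{osc}_z(\varphi)=\inf\{\mathrm{diam}\,\varphi(K'\cap O_z): O_z \text{ an open neighborhood of } z \text{ in } K\}$. A compactification $K$ is $M$-soft if for any bounded function $\varphi:K'\to M$ with $\{z\in K:\mathrm{osc}_z(\varphi)>0\}\neq\emptyset$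 there exist $g\in\mathcal H(K,K')$ and $\varepsilon>0$ such that $d_M(\varphi(g(x)),\varphi(x))\ge\varepsilon$ for infinitely many $x\in K'$. *)

theory Defs
  imports "HOL-Analysis.Analysis"
begin

unbundle cardinal_syntax

section \<open>Coarse spaces\<close>

definition entourage_on :: "'x set \<Rightarrow> ('x \<times> 'x) set \<Rightarrow> bool" where
  "entourage_on X E \<longleftrightarrow> Id_on X \<subseteq> E \<and> E \<subseteq> X \<times> X"

definition coarse_structure :: "'x set \<Rightarrow> ('x \<times> 'x) set set \<Rightarrow> bool" where
  "coarse_structure X \<E> \<longleftrightarrow>
     (\<forall>E\<in>\<E>. entourage_on X E) \<and>
     \<Union>\<E> = X \<times> X \<and>
     (\<forall>E\<in>\<E>. \<forall>F\<in>\<E>. \<exists>G\<in>\<E>. E O F\<inverse> \<subseteq> G) \<and>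
     (\<forall>E F. Id_on X \<subseteq> E \<and> E \<subseteq> F \<and> F \<in> \<E> \<longrightarrow> E \<in> \<E>)"

definition coarse_base :: "('x \<times> 'x) set set \<Rightarrow> ('x \<times> 'x) set set \<Rightarrow> bool" where
  "coarse_base \<E> \<B> \<longleftrightarrow> \<B> \<subseteq> \<E> \<and> (\<forall>E\<in>\<E>. \<exists>B\<in>\<B>. E \<subseteq> B)"

definition coarse_bounded :: "'x set \<Rightarrow> ('x \<times> 'x) set set \<Rightarrow> 'x set \<Rightarrow> bool" where
  "coarse_bounded X \<E> B \<longleftrightarrow> B \<subseteq> X \<and> (\<exists>E\<in>\<E>. \<exists>x\<in>X. B \<subseteq> E `` {x})"

definition finitary :: "'x set \<Rightarrow> ('x \<times> 'x) set set \<Rightarrow> bool" where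
  "finitary X \<E> \<longleftrightarrow> (\<forall>E\<in>\<E>. \<exists>n::nat. \<forall>x\<in>X. finite (E `` {x}) \<and> card (E `` {x}) \<le> n)"

definition cellular :: "'x set \<Rightarrow> ('x \<times> 'x) set set \<Rightarrow> bool" where
  "cellular X \<E> \<longleftrightarrow> (\<exists>\<B>. coarse_base \<E> \<B> \<and> (\<forall>B\<in>\<B>. equiv X B))"

definition coarse_discrete :: "'x set \<Rightarrow> ('x \<times> 'x) set set \<Rightarrow> 'x set \<Rightarrow> bool" where
  "coarse_discrete X \<E> D \<longleftrightarrow>
     D \<subseteq> X \<and> (\<forall>E\<in>\<E>. \<exists>B. coarse_bounded X \<E> B \<and> (\<forall>x\<in>D - B. D \<inter> E `` {x} = {x}))"

section \<open>The cardinal \<open>\<Delta>\<^sup>o\<^sub>\<omega>\<close>\<close>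

definition Delta_cell_bases :: "(nat \<times> nat) set set set" where
  "Delta_cell_bases = {\<B>. \<exists>\<E>. coarse_structure UNIV \<E> \<and> cellular UNIV \<E> \<and> finitary UNIV \<E> \<and>
     (\<nexists>D. infinite D \<and> coarse_discrete UNIV \<E> D) \<and> coarse_base \<E> \<B>}"

text \<open>\<open>Delta_cell_is \<kappa>\<close> says that the smallest cardinality of a member of
  \<^const>\<open>Delta_cell_bases\<close> is \<open>\<kappa>\<close>. It is a predicate, rather than a cardinal-valued constant,
  so that no junk value arises if there is no such base: then no \<open>\<kappa>\<close> satisfies it.\<close>

definition Delta_cell_is :: "'c rel \<Rightarrow> bool" where
  "Delta_cell_is \<kappa> \<longleftrightarrow>
     (\<exists>\<B>\<in>Delta_cell_bases. |\<B>| =o \<kappa>) \<and> (\<forall>\<B>\<in>Delta_cell_bases. \<kappa> \<le>o |\<B>| )"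

section \<open>Proper metric spaces and the \<open>M\<close>-compactification\<close>

text \<open>The metric space \<open>M\<close> is the type \<open>'m\<close>; it is passed as \<open>TYPE('m)\<close> where it cannot be inferred.\<close>

definition proper_space :: "'m::metric_space itself \<Rightarrow> bool" where
  "proper_space _ \<longleftrightarrow> (\<exists>a b::'m. a \<noteq> b) \<and> (\<forall>S::'m set. closed S \<and> bounded S \<longrightarrow> compact S)"

text \<open>\<^const>\<open>diameter\<close> is meaningful only for bounded sets; below it is always applied to
  subsets of the image of a bounded function.\<close>

definition slowly_oscillating ::
    "'x set \<Rightarrow> ('x \<times> 'x) set set \<Rightarrow> ('x \<Rightarrow> 'm::metric_space) \<Rightarrow> bool" where
  "slowly_oscillating X \<E> f \<longleftrightarrow>
     (\<forall>\<epsilon>>0. \<forall>E\<in>\<E>. \<exists>B. coarse_bounded X \<E> B \<and> (\<forall>x\<in>X - B. diameter (f ` (E `` {x})) < \<epsilon>))"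

text \<open>Functions \<open>X \<rightarrow> M\<close> are represented by extensional functions, so that each of them is
  exactly one index of the power \<open>M\<^bsup>so(X,\<E>;M)\<^esup>\<close>.\<close>

definition so :: "'x set \<Rightarrow> ('x \<times> 'x) set set \<Rightarrow> ('x \<Rightarrow> 'm::metric_space) set" where
  "so X \<E> = {f \<in> extensional X. bounded (f ` X) \<and> slowly_oscillating X \<E> f}"

definition so_embed ::
    "'x set \<Rightarrow> ('x \<times> 'x) set set \<Rightarrow> 'x \<Rightarrow> ('x \<Rightarrow> 'm::metric_space) \<Rightarrow> 'm" where
  "so_embed X \<E> x = (\<lambda>f\<in>so X \<E>. f x)"

definition so_power ::
    "'x set \<Rightarrow> ('x \<times> 'x) set set \<Rightarrow> (('x \<Rightarrow> 'm::metric_space) \<Rightarrow> 'm) topology" where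
  "so_power X \<E> = product_topology (\<lambda>_. euclidean) (so X \<E>)"

definition M_compactification ::
    "'x set \<Rightarrow> ('x \<times> 'x) set set \<Rightarrow> (('x \<Rightarrow> 'm::metric_space) \<Rightarrow> 'm) topology" where
  "M_compactification X \<E> =
     subtopology (so_power X \<E>) (so_power X \<E> closure_of (so_embed X \<E> ` X))"

section \<open>Compactifications\<close>

definition isolated_points :: "'k topology \<Rightarrow> 'k set" where
  "isolated_points K = {x \<in> topspace K. openin K {x}}"

definition compactification :: "'k topology \<Rightarrow> bool" where
  "compactification K \<longleftrightarrow>
     compact_space K \<and> Hausdorff_space K \<and> K closure_of isolated_points K = topspace K"

text \<open>The set \<open>X\<close> is identified with the set of isolated points of \<open>K\<close> by a map \<open>e\<close>;
  \<open>uc X e K\<close> is the set of restrictions to \<open>X\<close> of continuous functions on \<open>K\<close>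
  under this identification.\<close>

definition uc :: "'x set \<Rightarrow> ('x \<Rightarrow> 'k) \<Rightarrow> 'k topology \<Rightarrow> ('x \<Rightarrow> 'm::metric_space) set" where
  "uc X e K = {\<lambda>x\<in>X. f (e x) | f. continuous_map K euclidean f}"

definition M_equivalent ::
    "'m::metric_space itself \<Rightarrow> 'x set \<Rightarrow> ('x \<Rightarrow> 'k) \<Rightarrow> 'k topology \<Rightarrow> ('x \<Rightarrow> 'l) \<Rightarrow> 'l topology \<Rightarrow> bool"
  where
  "M_equivalent _ X e\<^sub>1 K\<^sub>1 e\<^sub>2 K\<^sub>2 \<longleftrightarrow>
     compactification K\<^sub>1 \<and> bij_betw e\<^sub>1 X (isolated_points K\<^sub>1) \<and>
     compactification K\<^sub>2 \<and> bij_betw e\<^sub>2 X (isolated_points K\<^sub>2) \<and>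
     (uc X e\<^sub>1 K\<^sub>1 :: ('x \<Rightarrow> 'm) set) = uc X e\<^sub>2 K\<^sub>2"

definition homeo_fixing_remainder :: "'k topology \<Rightarrow> ('k \<Rightarrow> 'k) set" where
  "homeo_fixing_remainder K =
     {g. homeomorphic_map K K g \<and> (\<forall>x\<in>topspace K - isolated_points K. g x = x)}"

definition osc :: "'k topology \<Rightarrow> ('k \<Rightarrow> 'm::metric_space) \<Rightarrow> 'k \<Rightarrow> real" where
  "osc K f z = (INF U\<in>{U. openin K U \<and> z \<in> U}. diameter (f ` (isolated_points K \<inter> U)))"

definition M_soft :: "'m::metric_space itself \<Rightarrow> 'k topology \<Rightarrow> bool" where
  "M_soft _ K \<longleftrightarrow>
     (\<forall>f::'k \<Rightarrow> 'm. bounded (f ` isolated_points K) \<and> {z \<in> topspace K. osc K f z > 0} \<noteq> {} \<longrightarrow>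
        (\<exists>g\<in>homeo_fixing_remainder K. \<exists>\<epsilon>>0.
           infinite {x \<in> isolated_points K. dist (f (g x)) (f x) \<ge> \<epsilon>}))"

end

theory Submission
  imports Defs
begin

text \<open>
  Let \<open>X\<close> be the set of isolated points of \<open>K\<close>; it is countable since \<open>K\<close> is separable. What has to be
  constructed is a cellular finitary coarse structure on \<open>X\<close> whose bounded slowly oscillating
  functions are precisely the functions that extend continuously to \<open>K\<close>: the
  \<open>M\<close>-compactification is then a continuous image of \<open>K\<close> with the same continuous functions into
  \<open>M\<close> (\<open>M_equivalent_if_so_eq_uc\<close>).

  The structure is built by transfinite recursion over the bounded functions \<open>\<phi>\<close> that do not
  extend, of which there are at most continuum many. Each stage contributes a relation that destroys
  the slow oscillation of one \<open>\<phi>\<close>, while all functions that do extend must stay slowly oscillating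
  and all classes uniformly finite. A function \<open>\<phi>\<close> that does not extend has positive oscillation
  somewhere (\<open>zero_osc_imp_uc\<close>), so softness yields a homeomorphism \<open>g\<close> of \<open>K\<close> that fixes the remainder
  and satisfies \<open>dist (\<phi> (g x)) (\<phi> x) \<ge> \<epsilon>\<close> for infinitely many \<open>x\<close>. The relation swaps \<open>x\<close> and \<open>g x\<close> for
  all \<open>x\<close> in a suitable infinite set \<open>D\<close> of such points. Functions that extend do not notice this, as
  they and their compositions with \<open>g\<close> agree on the remainder (\<open>uc_asymptotically_fixed\<close>).

  The danger is that the swaps chain up the existing classes into ever larger ones. This is excluded
  if \<open>D \<union> g ` D\<close> is discrete for the structure built so far, because then, up to finitely many
  exceptions, classes are merged in pairs only (\<open>adjoin_matching\<close>). Such a \<open>D\<close> exists: at each stage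
  the structure has a base of fewer than continuum many relations, so by the hypothesis on the cardinal
  every infinite subset of \<open>X\<close> contains an infinite discrete one (\<open>ex_infinite_discrete_subset\<close>). This
  makes \<open>D\<close> and \<open>g ` D\<close> discrete separately. That they are also asymptotically separated from each
  other is the contribution of \<open>\<phi>\<close> itself (\<open>ex_sparse_matching\<close>): if \<open>\<phi>\<close> is still slowly oscillating,
  and its values on \<open>D\<close> are nearly constant, then they are far from its values on \<open>g ` D\<close>, so no
  relation can link the two sets infinitely often.

  Limit stages are harmless since the base consists of joins of finitely many of the chosen relations,
  and these are controlled by the last relation involved (\<open>admissible_finite_joins\<close>).
\<close>

section \<open>Coarse structures generated by equivalence relations\<close>

definition unif_finite_equiv :: "'x set \<Rightarrow> ('x \<times> 'x) set \<Rightarrow> bool" where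
  "unif_finite_equiv X R \<longleftrightarrow> equiv X R \<and> (\<exists>n::nat. \<forall>x\<in>X. finite (R `` {x}) \<and> card (R `` {x}) \<le> n)"

text \<open>A coarse structure contains every pair of points, hence lets every finite set be glued together.
The thickening of an equivalence relation \<open>R\<close> fuses all \<open>R\<close>-classes that meet \<open>F\<close> into a single
class, so it is again an equivalence relation; closing a family of equivalence relations under
thickening is all that is needed to make it a base.\<close>

definition thicken :: "('x \<times> 'x) set \<Rightarrow> 'x set \<Rightarrow> ('x \<times> 'x) set" where
  "thicken R F = R \<union> (R `` F) \<times> (R `` F)"

definition thickenings :: "'x set \<Rightarrow> ('x \<times> 'x) set set \<Rightarrow> ('x \<times> 'x) set set" where
  "thickenings X \<R> = {thicken R F | R F. R \<in> \<R> \<and> finite F \<and> F \<subseteq> X}"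

definition generated_coarse :: "'x set \<Rightarrow> ('x \<times> 'x) set set \<Rightarrow> ('x \<times> 'x) set set" where
  "generated_coarse X \<R> = {E. Id_on X \<subseteq> E \<and> (\<exists>B\<in>thickenings X \<R>. E \<subseteq> B)}"

definition finitary_system :: "'x set \<Rightarrow> ('x \<times> 'x) set set \<Rightarrow> bool" where
  "finitary_system X \<R> \<longleftrightarrow> \<R> \<noteq> {} \<and> (\<forall>R\<in>\<R>. unif_finite_equiv X R) \<and>
     (\<forall>R\<in>\<R>. \<forall>S\<in>\<R>. \<exists>T\<in>\<R>. R \<union> S \<subseteq> T)"

lemma finitary_system_member: "finitary_system X \<R> \<Longrightarrow> R \<in> \<R> \<Longrightarrow> unif_finite_equiv X R"
  by (simp add: finitary_system_def)

lemma unif_finite_equivD: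
  assumes "unif_finite_equiv X R"
  shows "R \<subseteq> X \<times> X" "x \<in> X \<Longrightarrow> (x, x) \<in> R" "(x, y) \<in> R \<Longrightarrow> (y, x) \<in> R"
    "(x, y) \<in> R \<Longrightarrow> (y, z) \<in> R \<Longrightarrow> (x, z) \<in> R" "finite (R `` {x})"
proof -
  have R: "equiv X R" and fin: "\<And>x. x \<in> X \<Longrightarrow> finite (R `` {x})"
    using assms by (auto simp: unif_finite_equiv_def)
  show sub: "R \<subseteq> X \<times> X" and "x \<in> X \<Longrightarrow> (x, x) \<in> R" and "(x, y) \<in> R \<Longrightarrow> (y, x) \<in> R"
    and "(x, y) \<in> R \<Longrightarrow> (y, z) \<in> R \<Longrightarrow> (x, z) \<in> R"
    using R unfolding equiv_def by (auto simp: refl_on_def dest: symD transD)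
  have "R `` {x} = {}" if "x \<notin> X" using sub that by auto
  then show "finite (R `` {x})" using fin by fastforce
qed

lemma unif_finite_equiv_finite_Image:
  assumes "unif_finite_equiv X R" "finite F"
  shows "finite (R `` F)"
proof -
  have "R `` F = (\<Union>x\<in>F. R `` {x})" by auto
  then show ?thesis using assms unif_finite_equivD(5)[OF assms(1)] by simp
qed

text \<open>Only one new class arises, the union of the finitely many classes that meet \<open>F\<close>.\<close>

lemma unif_finite_equiv_thicken:
  assumes R: "unif_finite_equiv X R" and F: "finite F" "F \<subseteq> X"
  shows "unif_finite_equiv X (thicken R F)"
proof -
  note D = unif_finite_equivD[OF R]
  have "equiv X (thicken R F)"
  proof (rule equivI)
    show "thicken R F \<subseteq> X \<times> X" using D(1) by (auto simp: thicken_def)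
    show "refl_on X (thicken R F)" using D(2) by (auto simp: thicken_def refl_on_def)
    show "sym (thicken R F)" using D(3) by (auto simp: thicken_def sym_def)
    show "trans (thicken R F)"
    proof (rule transI)
      fix x y z assume "(x, y) \<in> thicken R F" "(y, z) \<in> thicken R F"
      then show "(x, z) \<in> thicken R F"
        using D(3,4) unfolding thicken_def by blast
    qed
  qed
  moreover obtain n where n: "\<And>x. x \<in> X \<Longrightarrow> card (R `` {x}) \<le> n"
    using R by (auto simp: unif_finite_equiv_def)
  have "finite (thicken R F `` {x}) \<and> card (thicken R F `` {x}) \<le> n + card (R `` F)"
    if "x \<in> X" for x
  proof -
    have sub: "thicken R F `` {x} \<subseteq> R `` {x} \<union> R `` F"
      by (auto simp: thicken_def)
    have fin: "finite (R `` {x} \<union> R `` F)"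
      using D(5) unif_finite_equiv_finite_Image[OF R F(1)] by blast
    have "card (thicken R F `` {x}) \<le> card (R `` {x}) + card (R `` F)"
      using card_mono[OF fin sub] card_Un_le[of "R `` {x}" "R `` F"] by linarith
    then show ?thesis using n[OF that] finite_subset[OF sub fin] by simp
  qed
  ultimately show ?thesis unfolding unif_finite_equiv_def by blast
qed

lemma thicken_mono: "R \<subseteq> S \<Longrightarrow> F \<subseteq> G \<Longrightarrow> thicken R F \<subseteq> thicken S G"
  unfolding thicken_def by blast

lemma thicken_in_generated_coarse:
  assumes "unif_finite_equiv X R" "R \<in> \<R>" "finite F" "F \<subseteq> X"
  shows "thicken R F \<in> generated_coarse X \<R>"
proof -
  have "thicken R F \<in> thickenings X \<R>"
    using assms(2-4) unfolding thickenings_def by blast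
  moreover have "Id_on X \<subseteq> thicken R F"
    using unif_finite_equivD(2)[OF assms(1)] by (auto simp: thicken_def)
  ultimately show ?thesis unfolding generated_coarse_def by blast
qed

lemma in_generated_coarse:
  assumes "unif_finite_equiv X R" "R \<in> \<R>"
  shows "R \<in> generated_coarse X \<R>"
  using thicken_in_generated_coarse[OF assms, of "{}"] by (simp add: thicken_def)

lemma generated_coarse_base:
  assumes sys: "finitary_system X \<R>"
  shows "coarse_base (generated_coarse X \<R>) (thickenings X \<R>)"
proof -
  have "thickenings X \<R> \<subseteq> generated_coarse X \<R>"
    using thicken_in_generated_coarse finitary_system_member[OF sys] unfolding thickenings_def by blast
  then show ?thesis
    unfolding coarse_base_def by (auto simp: generated_coarse_def)
qed

lemma cellular_generated_coarse:
  assumes sys: "finitary_system X \<R>"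
  shows "cellular X (generated_coarse X \<R>)"
proof -
  have "equiv X B" if B: "B \<in> thickenings X \<R>" for B
  proof -
    obtain R F where *: "R \<in> \<R>" "finite F" "F \<subseteq> X" "B = thicken R F"
      using B unfolding thickenings_def by blast
    then show ?thesis
      using unif_finite_equiv_thicken[OF finitary_system_member[OF sys *(1)] *(2,3)] by (simp add: unif_finite_equiv_def)
  qed
  then show ?thesis
    unfolding cellular_def using generated_coarse_base[OF sys] by blast
qed

lemma finitary_generated_coarse:
  assumes sys: "finitary_system X \<R>"
  shows "finitary X (generated_coarse X \<R>)"
  unfolding finitary_def
proof
  fix E assume "E \<in> generated_coarse X \<R>"
  then obtain R F where RF: "R \<in> \<R>" "finite F" "F \<subseteq> X" "E \<subseteq> thicken R F"
    unfolding generated_coarse_def thickenings_def by blast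
  have "unif_finite_equiv X (thicken R F)"
    using RF finitary_system_member[OF sys] unif_finite_equiv_thicken by blast
  then obtain n where n: "\<And>x. x \<in> X \<Longrightarrow> finite (thicken R F `` {x}) \<and> card (thicken R F `` {x}) \<le> n"
    unfolding unif_finite_equiv_def by blast
  have "finite (E `` {x}) \<and> card (E `` {x}) \<le> n" if "x \<in> X" for x
  proof -
    have "E `` {x} \<subseteq> thicken R F `` {x}" using RF by auto
    moreover have "finite (thicken R F `` {x})" "card (thicken R F `` {x}) \<le> n"
      using n[OF that] by auto
    ultimately show ?thesis
      by (meson card_mono finite_subset le_trans)
  qed
  then show "\<exists>n. \<forall>x\<in>X. finite (E `` {x}) \<and> card (E `` {x}) \<le> n" by blast
qed

text \<open>If \<open>T\<close> dominates two members of the directed family, then a thickening of \<open>T\<close> by the union of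
the two finite sets dominates both entourages; being symmetric and transitive, it also contains
their composition.\<close>

lemma coarse_structure_generated_coarse:
  assumes sys: "finitary_system X \<R>"
  shows "coarse_structure X (generated_coarse X \<R>)"
  unfolding coarse_structure_def
proof (intro conjI ballI allI impI)
  let ?\<E> = "generated_coarse X \<R>"
  have ent: "E \<subseteq> X \<times> X" if E: "E \<in> ?\<E>" for E
  proof -
    obtain R0 F where *: "R0 \<in> \<R>" "finite F" "F \<subseteq> X" "E \<subseteq> thicken R0 F"
      using E unfolding generated_coarse_def thickenings_def by blast
    then show ?thesis
      using unif_finite_equivD(1)[OF unif_finite_equiv_thicken[OF finitary_system_member[OF sys *(1)] *(2,3)]] by blast
  qed
  show "entourage_on X E" if "E \<in> ?\<E>" for E
    using ent[OF that] that unfolding entourage_on_def generated_coarse_def by blast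
  show "\<Union>?\<E> = X \<times> X"
  proof
    show "\<Union>?\<E> \<subseteq> X \<times> X" using ent by blast
    obtain R0 where R0: "R0 \<in> \<R>" using sys by (auto simp: finitary_system_def)
    have "(x, y) \<in> thicken R0 {x, y}" if "x \<in> X" "y \<in> X" for x y
      using unif_finite_equivD(2)[OF finitary_system_member[OF sys R0]] that by (auto simp: thicken_def)
    moreover have "thicken R0 {x, y} \<in> ?\<E>" if "x \<in> X" "y \<in> X" for x y
      using thicken_in_generated_coarse[OF finitary_system_member[OF sys R0] R0, of "{x, y}"] that by simp
    ultimately show "X \<times> X \<subseteq> \<Union>?\<E>"
      by blast
  qed
  show "\<exists>G\<in>?\<E>. E O F\<inverse> \<subseteq> G" if "E \<in> ?\<E>" "F \<in> ?\<E>" for E F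
  proof -
    obtain R1 F1 R2 F2 where *: "R1 \<in> \<R>" "finite F1" "F1 \<subseteq> X" "E \<subseteq> thicken R1 F1"
      "R2 \<in> \<R>" "finite F2" "F2 \<subseteq> X" "F \<subseteq> thicken R2 F2"
      using \<open>E \<in> ?\<E>\<close> \<open>F \<in> ?\<E>\<close> unfolding generated_coarse_def thickenings_def by blast
    obtain T where T: "T \<in> \<R>" "R1 \<union> R2 \<subseteq> T"
      using sys * unfolding finitary_system_def by meson
    let ?T = "thicken T (F1 \<union> F2)"
    have "E \<subseteq> ?T" "F \<subseteq> ?T"
      using * T thicken_mono[of R1 T F1 "F1 \<union> F2"] thicken_mono[of R2 T F2 "F1 \<union> F2"] by auto
    moreover have "unif_finite_equiv X ?T"
      using unif_finite_equiv_thicken[OF finitary_system_member[OF sys T(1)]] * by simp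
    ultimately have "E O F\<inverse> \<subseteq> ?T"
      using unif_finite_equivD(3,4)[of X ?T] by blast
    moreover have "?T \<in> ?\<E>"
      using thicken_in_generated_coarse[OF finitary_system_member[OF sys T(1)] T(1), of "F1 \<union> F2"] * by blast
    ultimately show ?thesis by blast
  qed
  show "E \<in> ?\<E>" if "Id_on X \<subseteq> E \<and> E \<subseteq> F \<and> F \<in> ?\<E>" for E F
    using that unfolding generated_coarse_def by blast
qed

text \<open>For empty \<open>X\<close> no set is bounded, because a bounded set needs a centre; this is why the case of
the empty space is separated off in the main proof.\<close>

lemma coarse_bounded_generated_coarse:
  assumes sys: "finitary_system X \<R>" and "X \<noteq> {}"
  shows "coarse_bounded X (generated_coarse X \<R>) B \<longleftrightarrow> finite B \<and> B \<subseteq> X"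
proof
  assume "coarse_bounded X (generated_coarse X \<R>) B"
  then obtain E x where E: "E \<in> generated_coarse X \<R>" "x \<in> X" "B \<subseteq> E `` {x}" and "B \<subseteq> X"
    unfolding coarse_bounded_def by blast
  moreover have "finitary X (generated_coarse X \<R>)"
    using sys by (rule finitary_generated_coarse)
  then have "finite (E `` {x})"
    using E unfolding finitary_def by blast
  ultimately show "finite B \<and> B \<subseteq> X"
    using finite_subset by blast
next
  assume B: "finite B \<and> B \<subseteq> X"
  obtain R0 where R0: "R0 \<in> \<R>" using sys by (auto simp: finitary_system_def)
  obtain x where x: "x \<in> X" using \<open>X \<noteq> {}\<close> by blast
  have "B \<subseteq> thicken R0 (insert x B) `` {x}"
    using unif_finite_equivD(2)[OF finitary_system_member[OF sys R0]] B x by (auto simp: thicken_def)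
  then show "coarse_bounded X (generated_coarse X \<R>) B"
    using thicken_in_generated_coarse[OF finitary_system_member[OF sys R0] R0, of "insert x B"] B x
    unfolding coarse_bounded_def by blast
qed

text \<open>Slow oscillation with respect to a single relation, phrased by pairs of points and finite sets:
in this form it is inherited by subrelations, and for equivalence relations that generate a
coarse structure it needs to be checked on the generators only.\<close>

definition tame :: "('x \<times> 'x) set \<Rightarrow> ('x \<Rightarrow> 'm::metric_space) \<Rightarrow> bool" where
  "tame R f \<longleftrightarrow> (\<forall>\<epsilon>>0. finite {x. \<exists>y. (x, y) \<in> R \<and> \<epsilon> \<le> dist (f x) (f y)})"

lemma tameD: "tame R f \<Longrightarrow> 0 < \<epsilon> \<Longrightarrow> finite {x. \<exists>y. (x, y) \<in> R \<and> \<epsilon> \<le> dist (f x) (f y)}"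
  by (simp add: tame_def)

lemma diameter_le_if_dist_le:
  fixes S :: "'a::metric_space set"
  assumes "0 \<le> d" "\<And>x y. x \<in> S \<Longrightarrow> y \<in> S \<Longrightarrow> dist x y \<le> d"
  shows "diameter S \<le> d"
proof (cases "S = {}")
  case False
  then have "(SUP (x, y)\<in>S \<times> S. dist x y) \<le> d"
    using assms(2) by (intro cSUP_least) auto
  then show ?thesis using False by (simp add: diameter_def)
qed (use assms(1) in simp)

text \<open>Thickening changes the classes of finitely many points only, and a bounded set may absorb those.\<close>

lemma slowly_oscillating_generated_coarse_iff:
  fixes f :: "'x \<Rightarrow> 'm::metric_space"
  assumes sys: "finitary_system X \<R>" and "X \<noteq> {}"
  shows "slowly_oscillating X (generated_coarse X \<R>) f \<longleftrightarrow> (\<forall>R\<in>\<R>. tame R f)"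
proof
  note bdd = coarse_bounded_generated_coarse[OF assms]
  assume so: "slowly_oscillating X (generated_coarse X \<R>) f"
  show "\<forall>R\<in>\<R>. tame R f"
    unfolding tame_def
  proof (intro ballI allI impI)
    fix R \<epsilon> assume RR: "R \<in> \<R>" and "(0::real) < \<epsilon>"
    then obtain B where B: "finite B" "\<And>x. x \<in> X - B \<Longrightarrow> diameter (f ` (R `` {x})) < \<epsilon>"
      using so in_generated_coarse[OF finitary_system_member[OF sys RR] RR]
      unfolding slowly_oscillating_def bdd by meson
    have "x \<in> B" if xy: "(x, y) \<in> R" and d: "\<epsilon> \<le> dist (f x) (f y)" for x y
    proof (rule ccontr)
      note D = unif_finite_equivD[OF finitary_system_member[OF sys RR]]
      assume "x \<notin> B"
      moreover have x: "x \<in> X" using D(1) xy by blast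
      ultimately have "diameter (f ` (R `` {x})) < \<epsilon>" using B by blast
      moreover have "bounded (f ` (R `` {x}))"
        using D(5)[of x] by (simp add: finite_imp_bounded)
      then have "dist (f x) (f y) \<le> diameter (f ` (R `` {x}))"
        by (rule diameter_bounded_bound) (use D(2)[OF x] xy in auto)
      ultimately show False using d by linarith
    qed
    then show "finite {x. \<exists>y. (x, y) \<in> R \<and> \<epsilon> \<le> dist (f x) (f y)}"
      by (intro finite_subset[OF _ B(1)]) auto
  qed
next
  note bdd = coarse_bounded_generated_coarse[OF assms]
  assume tame: "\<forall>R\<in>\<R>. tame R f"
  show "slowly_oscillating X (generated_coarse X \<R>) f"
    unfolding slowly_oscillating_def bdd
  proof (intro allI impI ballI)
    fix \<epsilon> :: real and E assume eps: "0 < \<epsilon>" and "E \<in> generated_coarse X \<R>"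
    then obtain R F where RF: "R \<in> \<R>" "finite F" "F \<subseteq> X" "E \<subseteq> thicken R F"
      unfolding generated_coarse_def thickenings_def by blast
    note D = unif_finite_equivD[OF finitary_system_member[OF sys RF(1)]]
    define B where "B = R `` F \<union> {x. \<exists>y. (x, y) \<in> R \<and> \<epsilon> / 4 \<le> dist (f x) (f y)}"
    have "finite B"
    proof -
      have "finite {x. \<exists>y. (x, y) \<in> R \<and> \<epsilon> / 4 \<le> dist (f x) (f y)}"
        using tame[rule_format, OF RF(1)] eps by (intro tameD) simp_all
      then show ?thesis
        using unif_finite_equiv_finite_Image[OF finitary_system_member[OF sys RF(1)] RF(2)]
        by (simp add: B_def)
    qed
    moreover have "B \<subseteq> X" using D(1) by (auto simp: B_def)
    moreover have "diameter (f ` (E `` {x})) < \<epsilon>" if "x \<in> X - B" for x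
    proof -
      have near: "dist (f x) (f y) < \<epsilon> / 4" if "y \<in> E `` {x}" for y
      proof -
        have "(x, y) \<in> R" using RF(4) that \<open>x \<in> X - B\<close> by (auto simp: B_def thicken_def)
        then show ?thesis using \<open>x \<in> X - B\<close> unfolding B_def by force
      qed
      have "diameter (f ` (E `` {x})) \<le> \<epsilon> / 2"
      proof (rule diameter_le_if_dist_le)
        fix u v assume "u \<in> f ` (E `` {x})" "v \<in> f ` (E `` {x})"
        then have "dist (f x) u < \<epsilon> / 4" "dist (f x) v < \<epsilon> / 4" using near by auto
        then show "dist u v \<le> \<epsilon> / 2"
          using dist_triangle3[of u v "f x"] by linarith
      qed (use eps in simp)
      then show ?thesis using eps by linarith
    qed
    ultimately show "\<exists>B. (finite B \<and> B \<subseteq> X) \<and> (\<forall>x\<in>X - B. diameter (f ` (E `` {x})) < \<epsilon>)"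
      by blast
  qed
qed

section \<open>Infinite discrete sets below the continuum\<close>

lemma countable_ordLess_real:
  assumes "countable A" shows "|A| <o |UNIV :: real set|"
proof -
  have "\<not> |UNIV :: real set| \<le>o |A|"
  proof
    assume "|UNIV :: real set| \<le>o |A|"
    then obtain f :: "real \<Rightarrow> 'a" where "inj f" "range f \<subseteq> A"
      by (auto simp: card_of_ordLeq[symmetric])
    then have "countable (UNIV :: real set)"
      using assms by (meson countable_subset countable_image_inj_on)
    then show False using uncountable_UNIV_real by blast
  qed
  then show ?thesis
    using not_ordLeq_iff_ordLess[OF card_of_Well_order card_of_Well_order] by blast
qed

lemma Times_countable_ordLess_real:
  assumes "|A| <o |UNIV :: real set|" "countable C"
  shows "|A \<times> C| <o |UNIV :: real set|"
proof (cases "finite A")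
  case True
  then show ?thesis using assms(2) by (intro countable_ordLess_real) (simp add: countable_finite)
next
  case False
  obtain f :: "'b \<Rightarrow> nat" where "inj_on f C" using assms(2) by (auto simp: countable_def)
  then have "|C| \<le>o |UNIV :: nat set|" by (intro card_of_ordLeqI[of f]) auto
  also have "|UNIV :: nat set| \<le>o |A|" using False by (simp add: infinite_iff_card_of_nat)
  finally have "|A \<times> C| \<le>o |A|"
    using False by (intro card_of_Times_ordLeq_infinite_Field) (auto simp: card_of_card_order_on Field_card_of card_of_mono1)
  then show ?thesis using assms(1) by (rule ordLeq_ordLess_trans)
qed

text \<open>By induction on \<open>n\<close>, the \<open>n\<close>-element subsets are no more numerous than the points: a set with
\<open>n + 1\<close> elements arises by inserting a point into one with \<open>n\<close>.\<close>

lemma card_of_finite_subsets_ordLeq: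
  assumes "infinite A"
  shows "|{T. finite T \<and> T \<subseteq> A}| \<le>o |A|"
proof -
  have level: "|{T. finite T \<and> T \<subseteq> A \<and> card T = n}| \<le>o |A|" for n
  proof (induction n)
    case 0
    have "{T. finite T \<and> T \<subseteq> A \<and> card T = 0} = {{}}" by auto
    then show ?case using assms by (auto intro!: card_of_singl_ordLeq)
  next
    case (Suc n)
    let ?L = "{T. finite T \<and> T \<subseteq> A \<and> card T = n}"
    have "{T. finite T \<and> T \<subseteq> A \<and> card T = Suc n} \<subseteq> (\<lambda>(a, T). insert a T) ` (A \<times> ?L)"
    proof
      fix T assume "T \<in> {T. finite T \<and> T \<subseteq> A \<and> card T = Suc n}"
      then obtain a T' where "T = insert a T'" "card T' = n" "finite T'" "a \<in> A" "T' \<subseteq> A"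
        by (auto simp: card_Suc_eq_finite)
      then show "T \<in> (\<lambda>(a, T). insert a T) ` (A \<times> ?L)"
        by (intro image_eqI[of _ _ "(a, T')"]) auto
    qed
    then have "|{T. finite T \<and> T \<subseteq> A \<and> card T = Suc n}| \<le>o |A \<times> ?L|"
      by (meson card_of_image card_of_mono1 ordLeq_transitive)
    also have "|A \<times> ?L| \<le>o |A|"
      using assms Suc by (intro card_of_Times_ordLeq_infinite_Field) (auto simp: card_of_card_order_on Field_card_of card_of_mono1)
    finally show ?case .
  qed
  have "{T. finite T \<and> T \<subseteq> A} = (\<Union>n. {T. finite T \<and> T \<subseteq> A \<and> card T = n})" by auto
  moreover have "|\<Union>n::nat. {T. finite T \<and> T \<subseteq> A \<and> card T = n}| \<le>o |A|"
    using assms level by (intro card_of_UNION_ordLeq_infinite) (auto simp: infinite_iff_card_of_nat)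
  ultimately show ?thesis by simp
qed

lemma finite_subsets_ordLess_real:
  assumes "|A| <o |UNIV :: real set|"
  shows "|{T. finite T \<and> T \<subseteq> A}| <o |UNIV :: real set|"
proof (cases "finite A")
  case True
  then show ?thesis by (intro countable_ordLess_real countable_Collect_finite_subset countable_finite)
next
  case False
  then show ?thesis using card_of_finite_subsets_ordLeq assms ordLeq_ordLess_trans by blast
qed

lemma finitary_system_pullback:
  assumes sys: "finitary_system X \<R>" and h: "inj_on h Y" "h ` Y \<subseteq> X"
  shows "finitary_system Y ((\<lambda>R. {(m, n). m \<in> Y \<and> n \<in> Y \<and> (h m, h n) \<in> R}) ` \<R>)"
proof -
  let ?p = "\<lambda>R. {(m, n). m \<in> Y \<and> n \<in> Y \<and> (h m, h n) \<in> R}"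
  have "unif_finite_equiv Y (?p R)" if "R \<in> \<R>" for R
  proof -
    have R: "unif_finite_equiv X R" using sys that by (rule finitary_system_member)
    note D = unif_finite_equivD[OF R]
    obtain n where n: "\<And>x. x \<in> X \<Longrightarrow> finite (R `` {x}) \<and> card (R `` {x}) \<le> n"
      using R unfolding unif_finite_equiv_def by blast
    have "equiv Y (?p R)"
    proof (rule equivI)
      show "?p R \<subseteq> Y \<times> Y" by blast
      show "refl_on Y (?p R)" using D(2) h(2) by (auto simp: refl_on_def)
      show "sym (?p R)" using D(3) by (auto simp: sym_def)
      show "trans (?p R)" using D(4) by (auto intro!: transI)
    qed
    moreover have "finite (?p R `` {y}) \<and> card (?p R `` {y}) \<le> n" if "y \<in> Y" for y
    proof -
      have sub: "h ` (?p R `` {y}) \<subseteq> R `` {h y}" by auto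
      have inj: "inj_on h (?p R `` {y})" using h(1) by (rule inj_on_subset) auto
      have "h y \<in> X" using h(2) that by auto
      then have "finite (R `` {h y})" "card (R `` {h y}) \<le> n" using n by auto
      then show ?thesis
        using inj_on_finite[OF inj sub] card_inj_on_le[OF inj sub] by simp
    qed
    ultimately show ?thesis unfolding unif_finite_equiv_def by blast
  qed
  moreover have "\<exists>T\<in>?p ` \<R>. ?p R \<union> ?p S \<subseteq> T" if RS: "R \<in> \<R>" "S \<in> \<R>" for R S
  proof -
    obtain T where "T \<in> \<R>" "R \<union> S \<subseteq> T" using sys RS unfolding finitary_system_def by meson
    then show ?thesis by (intro bexI[of _ "?p T"]) auto
  qed
  ultimately show ?thesis
    using sys unfolding finitary_system_def by simp
qed

lemma thickenings_ordLess_real: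
  assumes "|\<R>| <o |UNIV :: real set|" "countable X"
  shows "|thickenings X \<R>| <o |UNIV :: real set|"
proof -
  have "thickenings X \<R> = (\<lambda>(R, F). thicken R F) ` (\<R> \<times> {F. finite F \<and> F \<subseteq> X})"
    unfolding thickenings_def by (auto simp: image_iff)
  then have "|thickenings X \<R>| \<le>o |\<R> \<times> {F. finite F \<and> F \<subseteq> X}|"
    by (simp only: card_of_image)
  also have "|\<R> \<times> {F. finite F \<and> F \<subseteq> X}| <o |UNIV :: real set|"
    using assms by (intro Times_countable_ordLess_real countable_Collect_finite_subset)
  finally show ?thesis .
qed

text \<open>The only use of the cardinal hypothesis. The relations are restricted to \<open>A\<close>, and \<open>A\<close> is
identified with \<open>\<omega>\<close>. They then generate a cellular finitary structure on \<open>\<omega>\<close> with a base of fewer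
than continuum many sets, so by hypothesis that structure has an infinite discrete subset.\<close>

lemma ex_infinite_discrete_subset:
  assumes Delta: "Delta_cell_is |UNIV :: real set|"
    and sys: "finitary_system X \<R>" and small: "|\<R>| <o |UNIV :: real set|"
    and A: "infinite A" "countable A" "A \<subseteq> X"
  obtains D where "D \<subseteq> A" "infinite D" "\<forall>R\<in>\<R>. finite {x \<in> D. \<exists>y\<in>D. y \<noteq> x \<and> (x, y) \<in> R}"
proof -
  define h where "h = from_nat_into A"
  have h: "bij_betw h UNIV A" unfolding h_def using A by (intro bij_betw_from_nat_into)
  let ?p = "\<lambda>R. {(m, n). m \<in> (UNIV :: nat set) \<and> n \<in> UNIV \<and> (h m, h n) \<in> R}"
  let ?\<E> = "generated_coarse UNIV (?p ` \<R>)"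
  have psys: "finitary_system UNIV (?p ` \<R>)"
    using h A(3) by (intro finitary_system_pullback[OF sys]) (auto simp: bij_betw_def)
  have "|?p ` \<R>| <o |UNIV :: real set|"
    using card_of_image small by (rule ordLeq_ordLess_trans)
  then have "|thickenings UNIV (?p ` \<R>)| <o |UNIV :: real set|"
    by (rule thickenings_ordLess_real) simp
  then have "thickenings UNIV (?p ` \<R>) \<notin> Delta_cell_bases"
    using Delta unfolding Delta_cell_is_def by (meson not_ordLess_ordLeq)
  then obtain D where D: "infinite D" "coarse_discrete UNIV ?\<E> D"
    using coarse_structure_generated_coarse[OF psys] cellular_generated_coarse[OF psys]
      finitary_generated_coarse[OF psys] generated_coarse_base[OF psys]
    unfolding Delta_cell_bases_def by blast
  show ?thesis
  proof
    show "h ` D \<subseteq> A" using h by (auto simp: bij_betw_def)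
    have inj: "inj h" using h by (simp add: bij_betw_def)
    show "infinite (h ` D)" using D(1) finite_imageD inj_on_subset[OF inj] by blast
    show "\<forall>R\<in>\<R>. finite {x \<in> h ` D. \<exists>y\<in>h ` D. y \<noteq> x \<and> (x, y) \<in> R}"
    proof
      fix R assume "R \<in> \<R>"
      then have pR: "?p R \<in> ?p ` \<R>" by (rule imageI)
      then have "?p R \<in> ?\<E>"
        using in_generated_coarse[OF finitary_system_member[OF psys pR] pR] by simp
      then obtain B where "coarse_bounded UNIV ?\<E> B" and B: "\<forall>x\<in>D - B. D \<inter> ?p R `` {x} = {x}"
        using D(2) unfolding coarse_discrete_def by meson
      then have "finite B"
        using coarse_bounded_generated_coarse[OF psys] by simp
      moreover have "x \<in> h ` B" if x: "x \<in> h ` D" "y \<in> h ` D" "y \<noteq> x" "(x, y) \<in> R" for x y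
      proof -
        obtain m n where mn: "m \<in> D" "x = h m" "n \<in> D" "y = h n" using x by blast
        then have "n \<in> D \<inter> ?p R `` {m}" "n \<noteq> m" using x by auto
        then have "m \<in> B" using B mn(1) by blast
        then show ?thesis using mn(2) by blast
      qed
      then have "{x \<in> h ` D. \<exists>y\<in>h ` D. y \<noteq> x \<and> (x, y) \<in> R} \<subseteq> h ` B" by blast
      ultimately show "finite {x \<in> h ` D. \<exists>y\<in>h ` D. y \<noteq> x \<and> (x, y) \<in> R}"
        by (meson finite_imageI finite_subset)
    qed
  qed
qed

section \<open>Adjoining a sparse matching\<close>

text \<open>Here \<open>S\<close> is the graph of an involution on its domain. Let \<open>Z\<close> be the finite set of points of the
domain that share their \<open>R\<close>-class with another point of the domain. An \<open>R\<close>-class that avoids \<open>Z\<close>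
meets the domain in at most one point. If neither that class nor its partner under \<open>S\<close> meets \<open>Z\<close>,
adjoining \<open>S\<close> merges just these two, so sizes at most double and oscillations at most add up.
All the remaining merging happens inside the finite set \<open>P\<close> of points whose class meets \<open>Z\<close> or its
partners. If \<open>Domain S\<close> were not sparse in this way, chains of classes could grow without bound.\<close>

lemma adjoin_matching:
  assumes R: "unif_finite_equiv X R"
    and S: "sym S" "single_valued S" "S \<subseteq> X \<times> X"
    and sparse: "finite {z \<in> Domain S. \<exists>y\<in>Domain S. y \<noteq> z \<and> (z, y) \<in> R}"
  shows "unif_finite_equiv X ((R \<union> S)\<^sup>+)"
    and "tame R f \<Longrightarrow> tame S f \<Longrightarrow> tame ((R \<union> S)\<^sup>+) f"
proof -
  note D = unif_finite_equivD[OF R]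
  let ?Q = "(R \<union> S)\<^sup>+"
  have S_sym: "(y, x) \<in> S" if "(x, y) \<in> S" for x y using S(1) that by (rule symD)
  have S_fun: "y = z" if "(x, y) \<in> S" "(x, z) \<in> S" for x y z
    using S(2) that by (rule single_valuedD)
  have fin_S: "finite (S `` F)" if "finite F" for F
  proof -
    have "finite (S `` {x})" for x
    proof (cases "\<exists>y. (x, y) \<in> S")
      case True
      then obtain y where "(x, y) \<in> S" by blast
      then have "S `` {x} \<subseteq> {y}" using S_fun by blast
      then show ?thesis by (rule finite_subset) simp
    next
      case False
      then have "S `` {x} = {}" by blast
      then show ?thesis by simp
    qed
    moreover have "S `` F = (\<Union>x\<in>F. S `` {x})" by blast
    ultimately show ?thesis using that by simp
  qed
  have fin_R: "finite (R `` F)" if "finite F" for F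
    using R that by (rule unif_finite_equiv_finite_Image)

  define Z where "Z = {z \<in> Domain S. \<exists>y\<in>Domain S. y \<noteq> z \<and> (z, y) \<in> R}"
  define P where "P = R `` (Z \<union> S `` Z)"
  have fin_Z: "finite Z" using sparse by (simp add: Z_def)
  have fin_P: "finite P" by (simp add: P_def fin_R fin_S fin_Z)
  have clash: "z \<in> Z" if "z \<in> Domain S" "y \<in> Domain S" "(z, y) \<in> R" "y \<noteq> z" for y z
    using that by (auto simp: Z_def)
  have in_P: "z \<in> P" if "z \<in> Z \<union> S `` Z" for z
  proof -
    have "z \<in> X" using that S(3) by (auto simp: Z_def)
    then show ?thesis using that D(2) by (auto simp: P_def)
  qed
  \<comment> \<open>A class of the transitive closure is bounded by exhibiting a closed set around its point.\<close>
  have closed_class: "?Q `` {x} \<subseteq> C"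
    if "x \<in> C" and RC: "\<And>u v. u \<in> C \<Longrightarrow> (u, v) \<in> R \<Longrightarrow> v \<in> C"
      and SC: "\<And>u v. u \<in> C \<Longrightarrow> (u, v) \<in> S \<Longrightarrow> v \<in> C" for x C
  proof
    fix y assume "y \<in> ?Q `` {x}"
    then have "(x, y) \<in> ?Q" by simp
    then show "y \<in> C"
      by (induction rule: trancl_induct) (use \<open>x \<in> C\<close> RC SC in blast)+
  qed
  have class_P: "?Q `` {x} \<subseteq> P" if "x \<in> P" for x
  proof (rule closed_class[OF that])
    fix u v assume "u \<in> P" "(u, v) \<in> R"
    then show "v \<in> P" using D(4) unfolding P_def by blast
  next
    fix u v assume "u \<in> P" and uv: "(u, v) \<in> S"
    then obtain z where z: "z \<in> Z \<union> S `` Z" "(z, u) \<in> R" by (auto simp: P_def)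
    have zS: "z \<in> Domain S" using z(1) S_sym by (auto simp: Z_def)
    show "v \<in> P"
    proof (cases "u = z")
      case True
      then show ?thesis
        using z(1) uv S_sym S_fun in_P by (metis ImageE ImageI UnE UnI1 UnI2)
    next
      case False
      then have "u \<in> Z" using clash[of u z] zS uv D(3)[OF z(2)] by blast
      then show ?thesis using uv in_P by blast
    qed
  qed
  have class_not_P: "?Q `` {x} \<subseteq> R `` {x} \<union> R `` (S `` (R `` {x}))" if x: "x \<in> X" "x \<notin> P" for x
  proof (rule closed_class)
    show "x \<in> R `` {x} \<union> R `` (S `` (R `` {x}))" using D(2)[OF x(1)] by blast
  next
    fix u v assume "u \<in> R `` {x} \<union> R `` (S `` (R `` {x}))" "(u, v) \<in> R"
    then show "v \<in> R `` {x} \<union> R `` (S `` (R `` {x}))" using D(4) by blast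
  next
    fix u v assume u: "u \<in> R `` {x} \<union> R `` (S `` (R `` {x}))" and uv: "(u, v) \<in> S"
    show "v \<in> R `` {x} \<union> R `` (S `` (R `` {x}))"
    proof (cases "u \<in> R `` {x}")
      case True
      have "v \<in> X" using uv S(3) by blast
      then show ?thesis using True uv D(2)[of v] by blast
    next
      case False
      then obtain z w where zw: "(x, z) \<in> R" "(z, w) \<in> S" "(w, u) \<in> R" using u by blast
      have "u = w"
      proof (rule ccontr)
        assume "u \<noteq> w"
        then have "w \<in> Z" using clash[of w u] zw uv S_sym by blast
        then have "z \<in> S `` Z" using zw(2) S_sym by blast
        then have "x \<in> P" using D(3)[OF zw(1)] unfolding P_def by blast
        then show False using x(2) by blast
      qed
      then have "v = z" using uv zw(2) S_sym S_fun by blast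
      then show ?thesis using zw(1) by blast
    qed
  qed

  show "unif_finite_equiv X ?Q"
  proof -
    have "equiv X ?Q"
    proof (rule equivI)
      have "R \<union> S \<subseteq> X \<times> X" using D(1) S(3) by blast
      then show "?Q \<subseteq> X \<times> X" by (rule trancl_subset_Sigma)
      show "refl_on X ?Q" using D(2) by (auto simp: refl_on_def)
      have "sym (R \<union> S)" using D(3) S_sym by (auto simp: sym_def)
      then show "sym ?Q" by (rule sym_trancl)
    qed simp
    moreover obtain n where n: "\<And>x. x \<in> X \<Longrightarrow> card (R `` {x}) \<le> n"
      using R unfolding unif_finite_equiv_def by blast
    have "finite (?Q `` {x}) \<and> card (?Q `` {x}) \<le> card P + (n + n)" if x: "x \<in> X" for x
    proof (cases "x \<in> P")
      case True
      then show ?thesis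
        using finite_subset[OF class_P fin_P] card_mono[OF fin_P class_P] by fastforce
    next
      case False
      \<comment> \<open>Off \<open>P\<close> the class of \<open>x\<close> contains at most one point of the domain, hence has one partner class.\<close>
      have "card (R `` (S `` (R `` {x}))) \<le> n"
      proof (cases "S `` (R `` {x}) = {}")
        case False
        then obtain z w where zw: "(x, z) \<in> R" "(z, w) \<in> S" by blast
        have "S `` (R `` {x}) \<subseteq> {w}"
        proof
          fix w' assume "w' \<in> S `` (R `` {x})"
          then obtain z' where z': "(x, z') \<in> R" "(z', w') \<in> S" by blast
          have "z' = z"
          proof (rule ccontr)
            assume "z' \<noteq> z"
            then have "z \<in> Z" using clash[of z z'] z' zw D(3,4) by blast
            then have "x \<in> P" using D(3)[OF zw(1)] unfolding P_def by blast
            then show False using \<open>x \<notin> P\<close> by blast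
          qed
          then show "w' \<in> {w}" using z'(2) zw(2) S_fun by blast
        qed
        then have "S `` (R `` {x}) = {w}" using False by blast
        moreover have "w \<in> X" using zw(2) S(3) by blast
        ultimately show ?thesis using n by simp
      qed simp
      then have "card (R `` {x} \<union> R `` (S `` (R `` {x}))) \<le> n + n"
        using n[OF x] card_Un_le[of "R `` {x}" "R `` (S `` (R `` {x}))"] by linarith
      moreover have "finite (R `` {x} \<union> R `` (S `` (R `` {x})))"
        by (simp add: D(5) fin_R fin_S)
      ultimately show ?thesis
        using class_not_P[OF x False] by (meson card_mono finite_subset le_trans trans_le_add2)
    qed
    ultimately show ?thesis unfolding unif_finite_equiv_def by blast
  qed

  assume tame: "tame R f" "tame S f"
  show "tame ?Q f"
    unfolding tame_def
  proof (intro allI impI)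
    fix \<epsilon> :: real assume "0 < \<epsilon>"
    define BR where "BR = {x. \<exists>y. (x, y) \<in> R \<and> \<epsilon> / 3 \<le> dist (f x) (f y)}"
    define BS where "BS = {x. \<exists>y. (x, y) \<in> S \<and> \<epsilon> / 3 \<le> dist (f x) (f y)}"
    have eps3: "0 < \<epsilon> / 3" using \<open>0 < \<epsilon>\<close> by simp
    have fin_BR: "finite BR" unfolding BR_def using tame(1) eps3 by (rule tameD)
    have fin_BS: "finite BS" unfolding BS_def using tame(2) eps3 by (rule tameD)
    \<comment> \<open>A far pair is joined by at most three steps \<open>x, z, w, y\<close>, one of which has length \<open>\<epsilon> / 3\<close> or more.\<close>
    have "x \<in> P \<union> BR \<union> R `` BS \<union> R `` (S `` BR)"
      if xy: "(x, y) \<in> ?Q" and far: "\<epsilon> \<le> dist (f x) (f y)" for x y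
    proof (rule ccontr)
      assume x: "x \<notin> P \<union> BR \<union> R `` BS \<union> R `` (S `` BR)"
      have "R \<union> S \<subseteq> X \<times> X" using D(1) S(3) by blast
      then have "x \<in> X" using xy trancl_subset_Sigma by blast
      then have "y \<in> R `` {x} \<union> R `` (S `` (R `` {x}))" using class_not_P x xy by blast
      then show False
      proof
        assume "y \<in> R `` {x}"
        then have "dist (f x) (f y) < \<epsilon> / 3" using x by (force simp: BR_def)
        then show False using far \<open>0 < \<epsilon>\<close> by linarith
      next
        assume "y \<in> R `` (S `` (R `` {x}))"
        then obtain z w where zw: "(x, z) \<in> R" "(z, w) \<in> S" "(w, y) \<in> R" by blast
        have "dist (f x) (f z) < \<epsilon> / 3" using x zw(1) by (force simp: BR_def)
        moreover have "z \<notin> BS" using x D(3)[OF zw(1)] by blast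
        then have "dist (f z) (f w) < \<epsilon> / 3" using zw(2) by (force simp: BS_def)
        moreover have "w \<notin> BR" using x D(3)[OF zw(1)] S_sym[OF zw(2)] by blast
        then have "dist (f w) (f y) < \<epsilon> / 3" using zw(3) by (force simp: BR_def)
        ultimately show False
          using far dist_triangle[of "f x" "f y" "f z"] dist_triangle[of "f z" "f y" "f w"] by linarith
      qed
    qed
    then have "{x. \<exists>y. (x, y) \<in> ?Q \<and> \<epsilon> \<le> dist (f x) (f y)} \<subseteq> P \<union> BR \<union> R `` BS \<union> R `` (S `` BR)"
      by blast
    moreover have "finite (P \<union> BR \<union> R `` BS \<union> R `` (S `` BR))"
      by (simp add: fin_P fin_BR fin_BS fin_R fin_S)
    ultimately show "finite {x. \<exists>y. (x, y) \<in> ?Q \<and> \<epsilon> \<le> dist (f x) (f y)}"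
      by (rule finite_subset)
  qed
qed

section \<open>Compactifications and their isolated points\<close>

lemma openin_subset_isolated_points: "S \<subseteq> isolated_points K \<Longrightarrow> openin K S"
proof -
  assume S: "S \<subseteq> isolated_points K"
  have "openin K (\<Union>x\<in>S. {x})"
    using S by (intro openin_Union) (auto simp: isolated_points_def)
  then show ?thesis by simp
qed

lemma isolated_points_subset: "isolated_points K \<subseteq> topspace K"
  by (auto simp: isolated_points_def)

lemma isolated_points_subset_dense:
  assumes "K closure_of C = topspace K"
  shows "isolated_points K \<subseteq> C"
proof
  fix x assume "x \<in> isolated_points K"
  then have "x \<in> K closure_of C" "openin K {x}" using assms by (auto simp: isolated_points_def)
  then show "x \<in> C" unfolding in_closure_of by blast
qed

lemma countable_isolated_points: "separable_space K \<Longrightarrow> countable (isolated_points K)"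
  unfolding separable_space_def by (meson countable_subset isolated_points_subset_dense)

lemma homeo_fixing_remainder_bij_betw:
  assumes "g \<in> homeo_fixing_remainder K"
  shows "bij_betw g (isolated_points K) (isolated_points K)"
proof -
  have g: "homeomorphic_map K K g" using assms by (simp add: homeo_fixing_remainder_def)
  have bij: "inj_on g (topspace K)" "g ` topspace K = topspace K"
    using homeomorphic_imp_injective_map[OF g] homeomorphic_imp_surjective_map[OF g] .
  have iff: "g x \<in> isolated_points K \<longleftrightarrow> x \<in> isolated_points K" if "x \<in> topspace K" for x
  proof -
    have "g x \<in> topspace K" using that bij(2) by blast
    then show ?thesis
      using homeomorphic_map_openness[OF g, of "{x}"] that by (simp add: isolated_points_def)
  qed
  have "g ` isolated_points K = isolated_points K"
  proof
    show "g ` isolated_points K \<subseteq> isolated_points K"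
      using iff isolated_points_subset[of K] by blast
    show "isolated_points K \<subseteq> g ` isolated_points K"
    proof
      fix y assume y: "y \<in> isolated_points K"
      then obtain x where "x \<in> topspace K" "y = g x"
        using bij(2) isolated_points_subset[of K] by blast
      then show "y \<in> g ` isolated_points K" using iff y by blast
    qed
  qed
  then show ?thesis
    using inj_on_subset[OF bij(1) isolated_points_subset] by (simp add: bij_betw_def)
qed

lemma finite_closedin_isolated:
  assumes "compact_space K" "closedin K C" "C \<subseteq> isolated_points K"
  shows "finite C"
proof -
  have "compactin K C" using assms(1,2) by (rule closedin_compact_space)
  moreover have "\<forall>U\<in>(\<lambda>x. {x}) ` C. openin K U" "C \<subseteq> \<Union>((\<lambda>x. {x}) ` C)"
    using assms(3) by (auto simp: isolated_points_def)
  ultimately obtain \<F> where F: "finite \<F>" "\<F> \<subseteq> (\<lambda>x. {x}) ` C" "C \<subseteq> \<Union>\<F>"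
    unfolding compactin_def by meson
  have "finite (\<Union>\<F>)" 
  proof (rule finite_Union[OF F(1)])
    show "finite U" if "U \<in> \<F>" for U using F(2) that by blast
  qed
  then show ?thesis using F(3) finite_subset by blast
qed

text \<open>The points of \<open>K\<close> where a continuous \<open>F\<close> and \<open>F \<circ> g\<close> differ by at least \<open>\<epsilon>\<close> form a closed set. Since
\<open>g\<close> fixes the remainder, this set consists of isolated points, and by compactness it is finite.\<close>

lemma uc_asymptotically_fixed:
  fixes f :: "'k \<Rightarrow> 'm::metric_space"
  assumes K: "compact_space K" and f: "f \<in> uc (isolated_points K) id K"
    and g: "g \<in> homeo_fixing_remainder K" and "0 < \<epsilon>"
  shows "finite {x \<in> isolated_points K. \<epsilon> \<le> dist (f x) (f (g x))}"
proof -
  let ?X = "isolated_points K"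
  obtain F where F: "continuous_map K euclidean F" "f = (\<lambda>x\<in>?X. F x)"
    using f unfolding uc_def by auto
  have g': "homeomorphic_map K K g" "\<And>z. z \<in> topspace K - ?X \<Longrightarrow> g z = z"
    using g by (auto simp: homeo_fixing_remainder_def)
  have Fg: "continuous_map K euclidean (\<lambda>z. F (g z))"
    using continuous_map_compose[OF homeomorphic_imp_continuous_map[OF g'(1)] F(1)] by (simp add: o_def)
  let ?C = "{z \<in> topspace K. dist (F z) (F (g z)) \<in> {\<epsilon>..}}"
  have "continuous_map K euclidean (\<lambda>z. dist (F z) (F (g z)))"
    using continuous_map_mdist[of K euclidean_metric F "\<lambda>z. F (g z)"] F(1) Fg by simp
  then have "closedin K ?C"
    by (rule closedin_continuous_map_preimage) simp
  moreover have "?C \<subseteq> ?X" using g'(2) \<open>0 < \<epsilon>\<close> by force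
  ultimately have "finite ?C" by (rule finite_closedin_isolated[OF K])
  moreover have "{x \<in> ?X. \<epsilon> \<le> dist (f x) (f (g x))} \<subseteq> ?C"
    using bij_betwE[OF homeo_fixing_remainder_bij_betw[OF g]] isolated_points_subset[of K]
    by (auto simp: F(2))
  ultimately show ?thesis by (rule rev_finite_subset)
qed

lemma uc_bounded:
  fixes f :: "'k \<Rightarrow> 'm::metric_space"
  assumes "compact_space K" "f \<in> uc (isolated_points K) id K"
  shows "bounded (f ` isolated_points K)"
proof -
  obtain F where F: "continuous_map K (euclidean :: 'm topology) F" "f = (\<lambda>x\<in>isolated_points K. F x)"
    using assms(2) unfolding uc_def by auto
  have "compactin euclidean (F ` topspace K)"
    using assms(1) F(1) image_compactin unfolding compact_space_def by blast
  then have "bounded (F ` topspace K)" by (simp add: compact_imp_bounded)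
  then show ?thesis
    by (rule bounded_subset) (use isolated_points_subset[of K] in \<open>auto simp: F(2)\<close>)
qed

text \<open>Vanishing oscillation makes \<open>\<phi>\<close> Cauchy along the trace on the isolated points of the
neighbourhood filter of each \<open>z\<close>; the values lie in a compact set, so \<open>\<phi>\<close> has a limit at \<open>z\<close>.
Pointwise limits of a map into a regular space extend it continuously.\<close>

lemma zero_osc_imp_uc:
  fixes \<phi> :: "'k \<Rightarrow> 'm::metric_space"
  assumes M: "proper_space TYPE('m)"
    and dense: "K closure_of isolated_points K = topspace K"
    and ext: "\<phi> \<in> extensional (isolated_points K)" and bd: "bounded (\<phi> ` isolated_points K)"
    and osc: "\<And>z. z \<in> topspace K \<Longrightarrow> osc K \<phi> z \<le> 0"
  shows "\<phi> \<in> uc (isolated_points K) id K"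
proof -
  let ?X = "isolated_points K"
  have bd_sub: "bounded (\<phi> ` (?X \<inter> U))" for U
    by (rule bounded_subset[OF bd]) auto
  have small: "\<exists>U. openin K U \<and> z \<in> U \<and> diameter (\<phi> ` (?X \<inter> U)) < e"
    if "z \<in> topspace K" "0 < e" for z e
  proof -
    let ?N = "{U. openin K U \<and> z \<in> U}"
    have "?N \<noteq> {}" using that(1) by blast
    moreover have "bdd_below ((\<lambda>U. diameter (\<phi> ` (?X \<inter> U))) ` ?N)"
      by (rule bdd_belowI2[of _ 0]) (rule diameter_ge_0[OF bd_sub])
    moreover have "(INF U\<in>?N. diameter (\<phi> ` (?X \<inter> U))) < e"
      using osc[OF that(1)] that(2) unfolding osc_def by linarith
    ultimately show ?thesis by (auto simp: cINF_less_iff)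
  qed
  have lim: "\<exists>l. limitin euclidean \<phi> l (atin_within K z ?X)" if z: "z \<in> topspace K" for z
  proof -
    have "\<forall>n. \<exists>U. openin K U \<and> z \<in> U \<and> diameter (\<phi> ` (?X \<inter> U)) < inverse (real (Suc n))"
      using small[OF z] by simp
    then obtain U where U: "\<And>n. openin K (U n)" "\<And>n. z \<in> U n"
      "\<And>n. diameter (\<phi> ` (?X \<inter> U n)) < inverse (real (Suc n))" by metis
    have near: "dist (\<phi> x) (\<phi> y) < inverse (real (Suc n))" if "x \<in> ?X \<inter> U n" "y \<in> ?X \<inter> U n" for x y n
      using diameter_bounded_bound[OF bd_sub, of "\<phi> x" "U n" "\<phi> y"] that U(3)[of n] by force
    have meets: "\<exists>x. x \<in> ?X \<inter> V" if "openin K V" "z \<in> V" for V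
      using z dense that unfolding in_closure_of[symmetric] by (metis IntI in_closure_of)
    then have "\<forall>n. \<exists>x. x \<in> ?X \<inter> U n" using U by blast
    then obtain x where x: "\<And>n. x n \<in> ?X \<inter> U n" by metis
    \<comment> \<open>The \<open>U n\<close> need not decrease: \<open>x m\<close> and \<open>x n\<close> are compared through a point of \<open>U m \<inter> U n\<close>.\<close>
    have "Cauchy (\<lambda>n. \<phi> (x n))"
    proof (rule metric_CauchyI)
      fix e :: real assume "0 < e"
      then obtain N where N: "inverse (real (Suc N)) < e / 2"
        using reals_Archimedean[of "e/2"] by auto
      have "dist (\<phi> (x m)) (\<phi> (x n)) < e" if "N \<le> m" "N \<le> n" for m n
      proof -
        obtain y where y: "y \<in> ?X \<inter> (U m \<inter> U n)"
          using meets[of "U m \<inter> U n"] U by blast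
        have "inverse (real (Suc m)) \<le> inverse (real (Suc N))"
          "inverse (real (Suc n)) \<le> inverse (real (Suc N))"
          using that by (auto simp: le_imp_inverse_le)
        moreover have "dist (\<phi> (x m)) (\<phi> y) < inverse (real (Suc m))"
          "dist (\<phi> (x n)) (\<phi> y) < inverse (real (Suc n))"
          using near[OF x] y by blast+
        ultimately show ?thesis
          using N dist_triangle2[of "\<phi> (x m)" "\<phi> (x n)" "\<phi> y"] by linarith
      qed
      then show "\<exists>N. \<forall>m\<ge>N. \<forall>n\<ge>N. dist (\<phi> (x m)) (\<phi> (x n)) < e" by blast
    qed
    moreover have "complete (closure (\<phi> ` ?X))"
    proof (rule compact_imp_complete)
      show "compact (closure (\<phi> ` ?X))"
        using M bd bounded_closure closed_closure unfolding proper_space_def by blast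
    qed
    moreover have "\<forall>n. \<phi> (x n) \<in> closure (\<phi> ` ?X)"
      using x closure_subset by blast
    ultimately obtain l where l: "(\<lambda>n. \<phi> (x n)) \<longlonglongrightarrow> l"
      unfolding complete_def by (metis (no_types, lifting))
    have "limitin euclidean \<phi> l (atin_within K z ?X)"
      unfolding limitin_def
    proof (intro conjI allI impI)
      fix V assume "openin euclidean V \<and> l \<in> V"
      then obtain r where r: "0 < r" "ball l r \<subseteq> V" by (auto simp: open_contains_ball)
      obtain N1 where N1: "inverse (real (Suc N1)) < r / 2"
        using r(1) reals_Archimedean[of "r/2"] by auto
      obtain N2 where N2: "\<And>n. N2 \<le> n \<Longrightarrow> dist (\<phi> (x n)) l < r / 2"
        using metric_LIMSEQ_D[OF l, of "r/2"] r(1) by auto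
      define n where "n = max N1 N2"
      have "inverse (real (Suc n)) \<le> inverse (real (Suc N1))"
        by (intro le_imp_inverse_le) (auto simp: n_def)
      then have n: "inverse (real (Suc n)) < r / 2" "dist (\<phi> (x n)) l < r / 2"
        using N2[of n] N1 by (linarith, simp add: n_def)
      have "\<phi> y \<in> V" if "y \<in> U n" "y \<in> ?X" for y
      proof -
        have "dist (\<phi> (x n)) (\<phi> y) < inverse (real (Suc n))" using near[OF x] that by blast
        then have "dist l (\<phi> y) < r" using n dist_triangle3[of l "\<phi> y" "\<phi> (x n)"] by linarith
        then show ?thesis using r(2) by auto
      qed
      then show "eventually (\<lambda>y. \<phi> y \<in> V) (atin_within K z ?X)"
        unfolding eventually_atin_within using U by blast
    qed simp
    then show ?thesis by blast
  qed
  have discrete: "openin (subtopology K ?X) S" if "S \<subseteq> ?X" for S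
    using openin_subset_isolated_points[OF that] that openin_subtopology_Int[of K S ?X]
    by (simp add: inf.absorb1)
  have "continuous_map (subtopology K ?X) euclidean \<phi>"
    unfolding continuous_map_def by (auto intro!: discrete)
  then obtain F where F: "continuous_map (subtopology K (topspace K)) euclidean F"
    "\<And>x. x \<in> ?X \<Longrightarrow> F x = \<phi> x"
    using continuous_map_extension_pointwise_alt[of euclidean ?X "topspace K" K \<phi>]
      regular_space_euclidean isolated_points_subset dense lim
    by (metis (no_types, lifting) DiffD1 order_refl)
  have "\<phi> = (\<lambda>x\<in>?X. F (id x))"
    using ext F(2) by (auto simp: extensional_def)
  then show ?thesis using F(1) unfolding uc_def by auto
qed

text \<open>If the slowly oscillating functions are those that extend continuously to \<open>K\<close>, then the
extensions assemble to a continuous map \<open>j\<close> of \<open>K\<close> into the power of \<open>M\<close> that agrees with the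
canonical embedding on the isolated points. Its image is compact, hence closed, hence the whole
\<open>M\<close>-compactification. So continuous functions on the latter pull back to \<open>K\<close>, while
the coordinate projections supply the converse inclusion. The embedded points are isolated
because functions taking one value at a point and a different one elsewhere extend to \<open>K\<close>.\<close>

lemma M_equivalent_if_so_eq_uc:
  fixes K :: "'k topology"
  assumes M: "proper_space TYPE('m::metric_space)" and K: "compactification K"
    and so_uc: "(so (isolated_points K) \<E> :: ('k \<Rightarrow> 'm) set) = uc (isolated_points K) id K"
  shows "M_equivalent TYPE('m) (isolated_points K) id K
     (so_embed (isolated_points K) \<E> :: 'k \<Rightarrow> ('k \<Rightarrow> 'm) \<Rightarrow> 'm)
     (M_compactification (isolated_points K) \<E>)"
proof -
  let ?X = "isolated_points K"
  let ?so = "so ?X \<E> :: ('k \<Rightarrow> 'm) set"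
  let ?P = "so_power ?X \<E> :: (('k \<Rightarrow> 'm) \<Rightarrow> 'm) topology"
  let ?e = "so_embed ?X \<E> :: 'k \<Rightarrow> ('k \<Rightarrow> 'm) \<Rightarrow> 'm"
  let ?L = "M_compactification ?X \<E> :: (('k \<Rightarrow> 'm) \<Rightarrow> 'm) topology"
  have comp: "compact_space K" and Haus: "Hausdorff_space K" and dense: "K closure_of ?X = topspace K"
    using K by (auto simp: compactification_def)
  have top_P: "topspace ?P = (\<Pi>\<^sub>E f\<in>?so. UNIV)" by (simp add: so_power_def)
  have eX: "?e ` ?X \<subseteq> topspace ?P" by (auto simp: top_P so_embed_def)
  have proj: "continuous_map ?P euclidean (\<lambda>h. h f)" if "f \<in> ?so" for f
    using that unfolding so_power_def by (rule continuous_map_product_projection)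
  have "\<forall>f\<in>?so. \<exists>F. continuous_map K euclidean F \<and> f = (\<lambda>x\<in>?X. F x)"
    unfolding so_uc uc_def by auto
  then obtain ext where ext: "\<And>f. f \<in> ?so \<Longrightarrow> continuous_map K euclidean (ext f)"
    "\<And>f. f \<in> ?so \<Longrightarrow> f = (\<lambda>x\<in>?X. ext f x)" by metis
  define j where "j z = (\<lambda>f\<in>?so. ext f z)" for z
  have j: "continuous_map K ?P j"
    unfolding so_power_def continuous_map_componentwise by (auto simp: j_def ext(1))
  have j_e: "j x = ?e x" if "x \<in> ?X" for x
    using ext(2) that by (auto simp: j_def so_embed_def restrict_def) (metis restrict_apply')
  have Haus_P: "Hausdorff_space ?P"
    by (simp add: so_power_def Hausdorff_space_product_topology)
  have "compactin ?P (j ` topspace K)"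
    using comp j image_compactin unfolding compact_space_def by blast
  then have closed_j: "closedin ?P (j ` topspace K)"
    using Haus_P compactin_imp_closedin by blast
  have jK: "j ` topspace K = ?P closure_of (?e ` ?X)"
  proof
    have "j ` topspace K \<subseteq> ?P closure_of (j ` ?X)"
      using continuous_map_image_closure_subset[OF j, of ?X] dense by simp
    then show "j ` topspace K \<subseteq> ?P closure_of (?e ` ?X)"
      using j_e by (metis (no_types, lifting) image_cong)
    have "?e ` ?X \<subseteq> j ` topspace K"
      using j_e isolated_points_subset[of K] by force
    then show "?P closure_of (?e ` ?X) \<subseteq> j ` topspace K"
      using closed_j by (rule closure_of_minimal)
  qed
  have L: "?L = subtopology ?P (j ` topspace K)"
    by (simp add: M_compactification_def jK)
  have top_L: "topspace ?L = ?P closure_of (?e ` ?X)"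
    by (simp add: M_compactification_def closure_of_subset_topspace Int_absorb1)
  have eX_L: "?e ` ?X \<subseteq> topspace ?L" unfolding top_L using eX by (rule closure_of_subset)
  have dense_L: "?L closure_of (?e ` ?X) = topspace ?L"
    using closure_of_subset[OF eX]
    using closure_of_subset_topspace[of ?P "?e ` ?X"]
    by (simp add: M_compactification_def closure_of_subtopology Int_absorb1 Int_absorb2)
  obtain a b :: 'm where ab: "a \<noteq> b" using M by (auto simp: proper_space_def)
  define peak where "peak x = (\<lambda>y\<in>?X. if y = x then a else b)" for x :: 'k
  have chi: "peak x \<in> ?so" if "x \<in> ?X" for x
  proof -
    have "continuous_map K euclidean (\<lambda>y. if y = x then a else b)"
    proof -
      have x: "openin K {x}" "openin K (topspace K - {x})"
        using that closedin_Hausdorff_sing_eq[OF Haus, of x] by (auto simp: isolated_points_def)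
      have "{y \<in> topspace K. (if y = x then a else b) \<in> U}
          = (if a \<in> U then {x} else {}) \<union> (if b \<in> U then topspace K - {x} else {})" for U
        using that isolated_points_subset[of K] by auto
      moreover have "openin K ((if a \<in> U then {x} else {}) \<union> (if b \<in> U then topspace K - {x} else {}))" for U
        using x by (intro openin_Un) simp_all
      ultimately show ?thesis unfolding continuous_map_def by simp
    qed
    then show ?thesis unfolding so_uc uc_def peak_def by auto
  qed
  have inj: "inj_on ?e ?X"
  proof (rule inj_onI)
    fix x y assume xy: "x \<in> ?X" "y \<in> ?X" "?e x = ?e y"
    then have "peak x x = peak x y" using chi[OF xy(1)] by (metis restrict_apply' so_embed_def)
    then show "x = y" using ab xy by (auto simp: peak_def split: if_splits)
  qed
  have iso_L: "isolated_points ?L = ?e ` ?X"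
  proof
    show "isolated_points ?L \<subseteq> ?e ` ?X" using dense_L by (rule isolated_points_subset_dense)
    show "?e ` ?X \<subseteq> isolated_points ?L"
    proof
      fix h assume "h \<in> ?e ` ?X"
      then obtain x where x: "x \<in> ?X" "h = ?e x" by blast
      let ?V = "{h \<in> topspace ?L. h (peak x) \<in> - {b}}"
      have "continuous_map ?L euclidean (\<lambda>h. h (peak x))"
        using proj[OF chi[OF x(1)]] unfolding L by (rule continuous_map_from_subtopology)
      then have V: "openin ?L ?V"
        by (rule openin_continuous_map_preimage) auto
      have hV: "?V \<inter> ?e ` ?X = {?e x}"
      proof
        have val: "?e y (peak x) = (if y = x then a else b)" if "y \<in> ?X" for y
          using chi[OF x(1)] that by (simp add: so_embed_def) (simp add: peak_def x(1))
        show "?V \<inter> ?e ` ?X \<subseteq> {?e x}" using val by (auto split: if_splits)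
        show "{?e x} \<subseteq> ?V \<inter> ?e ` ?X" using val[OF x(1)] eX_L x(1) ab by auto
      qed
      have "Hausdorff_space ?L" unfolding L using Haus_P by (rule Hausdorff_space_subtopology)
      then have "closedin ?L {?e x}"
        using eX_L x by (intro closedin_Hausdorff_sing_eq[THEN iffD2]) auto
      then have "?L closure_of {?e x} = {?e x}" by (rule closure_of_closedin)
      then have "?V \<subseteq> {?e x}"
        using openin_Int_closure_of_subset[OF V, of "?e ` ?X"] hV dense_L by auto
      then have "?V = {?e x}" using hV by blast
      then show "h \<in> isolated_points ?L" using V x eX_L by (auto simp: isolated_points_def)
    qed
  qed
  have "compactification ?L"
    unfolding compactification_def
  proof (intro conjI)
    show "compact_space ?L"
      unfolding L using \<open>compactin ?P (j ` topspace K)\<close> by (rule compact_space_subtopology)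
    show "Hausdorff_space ?L" unfolding L using Haus_P by (rule Hausdorff_space_subtopology)
    show "?L closure_of isolated_points ?L = topspace ?L" using dense_L by (simp add: iso_L)
  qed
  moreover have "(uc ?X id K :: ('k \<Rightarrow> 'm) set) = uc ?X ?e ?L"
  proof
    show "(uc ?X id K :: ('k \<Rightarrow> 'm) set) \<subseteq> uc ?X ?e ?L"
    proof
      fix f :: "'k \<Rightarrow> 'm" assume "f \<in> uc ?X id K"
      then have f: "f \<in> ?so" by (simp add: so_uc)
      have "continuous_map ?L euclidean (\<lambda>h. h f)"
        using proj[OF f] unfolding L by (rule continuous_map_from_subtopology)
      moreover have "f = (\<lambda>x\<in>?X. ?e x f)"
        using f ext(2)[OF f] by (auto simp: so_embed_def restrict_def) metis
      ultimately show "f \<in> uc ?X ?e ?L"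
        unfolding uc_def by (intro CollectI exI[of _ "\<lambda>h. h f"]) simp
    qed
    show "uc ?X ?e ?L \<subseteq> (uc ?X id K :: ('k \<Rightarrow> 'm) set)"
    proof
      fix f :: "'k \<Rightarrow> 'm" assume "f \<in> uc ?X ?e ?L"
      then obtain F where F: "continuous_map ?L euclidean F" "f = (\<lambda>x\<in>?X. F (?e x))"
        unfolding uc_def by auto
      have "continuous_map K ?L j" unfolding L using j by (simp add: continuous_map_in_subtopology)
      then have "continuous_map K euclidean (\<lambda>z. F (j z))"
        using continuous_map_compose[OF _ F(1), of K j] by (simp add: o_def)
      moreover have "f = (\<lambda>x\<in>?X. F (j (id x)))" using j_e by (auto simp: F(2))
      ultimately show "f \<in> uc ?X id K"
        unfolding uc_def by (intro CollectI exI[of _ "\<lambda>z. F (j z)"]) simp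
    qed
  qed
  ultimately show ?thesis
    unfolding M_equivalent_def using K inj iso_L by (auto simp: bij_betw_def)
qed

section \<open>Destroying one function that does not extend\<close>

text \<open>A proper metric space is separable. With a countable dense set \<open>C\<close>, a function on \<open>X\<close> is encoded
by the set of triples \<open>(x, c, m)\<close> such that its value at \<open>x\<close> is within \<open>1 / (m + 1)\<close> of \<open>c\<close>.\<close>

lemma card_of_functions_ordLeq_real:
  assumes M: "proper_space TYPE('m::metric_space)" and X: "countable (X :: 'x set)"
  shows "|extensional X :: ('x \<Rightarrow> 'm) set| \<le>o |UNIV :: real set|"
proof -
  fix a :: 'm
  have "\<exists>k. finite k \<and> cball a (real n) \<subseteq> (\<Union>c\<in>k. ball c (inverse (real (Suc m))))" for n m
  proof -
    have "compact (cball a (real n))" using M by (simp add: proper_space_def)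
    then show ?thesis unfolding compact_eq_totally_bounded by simp
  qed
  then obtain k where k: "\<And>n m. finite (k n m)"
    "\<And>n m. cball a (real n) \<subseteq> (\<Union>c\<in>k n m. ball c (inverse (real (Suc m))))" by metis
  define C where "C = (\<Union>n m. k n m)"
  have C: "countable C" unfolding C_def using k(1) by (simp add: countable_finite)
  have dense: "\<exists>c\<in>C. dist c x < inverse (real (Suc m))" for x m
  proof -
    obtain n where "dist a x \<le> real n" using real_arch_simple by blast
    then have "x \<in> (\<Union>c\<in>k n m. ball c (inverse (real (Suc m))))"
      using k(2)[of n m] by (auto simp: subset_iff)
    then show ?thesis by (auto simp: C_def)
  qed
  let ?S = "X \<times> C \<times> (UNIV :: nat set)"
  define G where "G f = {(x, c, m). x \<in> X \<and> c \<in> C \<and> dist c (f x) < inverse (real (Suc m))}"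
    for f :: "'x \<Rightarrow> 'm"
  have "inj_on G (extensional X)"
  proof (rule inj_onI)
    fix f f' :: "'x \<Rightarrow> 'm" assume ff: "f \<in> extensional X" "f' \<in> extensional X" "G f = G f'"
    have "f x = f' x" if x: "x \<in> X" for x
    proof -
      have "dist (f x) (f' x) < e" if e: "0 < e" for e
      proof -
        obtain m where m: "inverse (real (Suc m)) < e / 2"
          using reals_Archimedean[of "e / 2"] e by (meson half_gt_zero)
        obtain c where c: "c \<in> C" "dist c (f x) < inverse (real (Suc m))" using dense by blast
        then have "(x, c, m) \<in> G f" using x by (simp add: G_def)
        then have "(x, c, m) \<in> G f'" using ff(3) by simp
        then have "dist c (f' x) < inverse (real (Suc m))" by (simp add: G_def)
        then show ?thesis using c(2) m dist_triangle3[of "f x" "f' x" c] by linarith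
      qed
      then show ?thesis by (metis dist_pos_lt less_irrefl)
    qed
    then show "f = f'" using ff(1,2) by (intro extensionalityI)
  qed
  then have "|extensional X :: ('x \<Rightarrow> 'm) set| \<le>o |Pow ?S|"
    by (rule card_of_ordLeqI) (auto simp: G_def)
  also have "|Pow ?S| \<le>o |UNIV :: nat set set|"
  proof -
    have "countable ?S" using X C by simp
    then obtain h :: "'x \<times> 'm \<times> nat \<Rightarrow> nat" where "inj_on h ?S" by (auto simp: countable_def)
    then have "inj_on ((`) h) (Pow ?S)" by (rule inj_on_image_Pow)
    then show ?thesis by (rule card_of_ordLeqI) simp
  qed
  also have "|UNIV :: nat set set| =o |UNIV :: real set|"
    using nat_sets_eqpoll_reals by (simp add: eqpoll_iff_card_of_ordIso)
  finally show ?thesis .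
qed

text \<open>By compactness, infinitely many of the points \<open>x\<close> that \<open>g\<close> displaces visibly have almost equal
values \<open>\<phi> x\<close>. On such a set \<open>A\<close>, each value \<open>\<phi> x\<close> is far from each \<open>\<phi> (g y)\<close>; as \<open>\<phi>\<close>
oscillates slowly, every relation links only finitely many points of \<open>A\<close> with points of \<open>g ` A\<close>.
It remains to thin \<open>A\<close> out to a discrete set, and then its image under \<open>g\<close> to a discrete set:
the slow oscillation of \<open>\<phi>\<close> has already taken care of the links between the two halves.\<close>

lemma ex_sparse_matching:
  fixes \<phi> :: "'x \<Rightarrow> 'm::metric_space"
  assumes M: "proper_space TYPE('m)" and Delta: "Delta_cell_is |UNIV :: real set|"
    and sys: "finitary_system X \<R>" and small: "|\<R>| <o |UNIV :: real set|"
    and X: "countable X" and g: "bij_betw g X X" and bd: "bounded (\<phi> ` X)"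
    and tame: "\<And>R. R \<in> \<R> \<Longrightarrow> tame R \<phi>"
    and "0 < \<epsilon>" and far: "infinite {x \<in> X. \<epsilon> \<le> dist (\<phi> (g x)) (\<phi> x)}"
  obtains D where "D \<subseteq> X" "infinite D" "D \<inter> g ` D = {}" "\<forall>x\<in>D. \<epsilon> \<le> dist (\<phi> (g x)) (\<phi> x)"
    "\<forall>R\<in>\<R>. finite {z \<in> D \<union> g ` D. \<exists>y\<in>D \<union> g ` D. y \<noteq> z \<and> (z, y) \<in> R}"
proof -
  have "compact (closure (\<phi> ` X))"
    using M bd bounded_closure closed_closure unfolding proper_space_def by blast
  then obtain k where k: "finite k" "closure (\<phi> ` X) \<subseteq> (\<Union>c\<in>k. ball c (\<epsilon> / 4))"
    unfolding compact_eq_totally_bounded using \<open>0 < \<epsilon>\<close> by (meson divide_pos_pos zero_less_numeral)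
  let ?far = "{x \<in> X. \<epsilon> \<le> dist (\<phi> (g x)) (\<phi> x)}"
  have "\<exists>c\<in>k. infinite {x \<in> ?far. \<phi> x \<in> ball c (\<epsilon> / 4)}"
  proof (rule pigeonhole_infinite_rel[OF far k(1)])
    show "\<forall>x\<in>?far. \<exists>c\<in>k. \<phi> x \<in> ball c (\<epsilon> / 4)"
      using k(2) closure_subset[of "\<phi> ` X"] by blast
  qed
  then obtain c where "infinite {x \<in> ?far. \<phi> x \<in> ball c (\<epsilon> / 4)}" by blast
  define A where "A = {x \<in> ?far. \<phi> x \<in> ball c (\<epsilon> / 4)}"
  have A: "infinite A" "A \<subseteq> X" "\<And>x. x \<in> A \<Longrightarrow> \<epsilon> \<le> dist (\<phi> (g x)) (\<phi> x)"
    using \<open>infinite {x \<in> ?far. \<phi> x \<in> ball c (\<epsilon> / 4)}\<close> by (auto simp: A_def)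
  have apart: "\<epsilon> / 2 \<le> dist (\<phi> x) (\<phi> (g y))" if "x \<in> A" "y \<in> A" for x y
  proof -
    have "dist c (\<phi> x) < \<epsilon> / 4" "dist c (\<phi> y) < \<epsilon> / 4" using that by (auto simp: A_def)
    then have "dist (\<phi> x) (\<phi> y) < \<epsilon> / 2" using dist_triangle3[of "\<phi> x" "\<phi> y" c] by linarith
    moreover have "dist (\<phi> (g y)) (\<phi> y) \<le> dist (\<phi> x) (\<phi> (g y)) + dist (\<phi> x) (\<phi> y)"
      by (rule dist_triangle3)
    ultimately show ?thesis using A(3)[OF that(2)] by linarith
  qed
  have "countable A" using X A(2) countable_subset by blast
  obtain D1 where D1: "D1 \<subseteq> A" "infinite D1"
    "\<forall>R\<in>\<R>. finite {x \<in> D1. \<exists>y\<in>D1. y \<noteq> x \<and> (x, y) \<in> R}"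
    by (rule ex_infinite_discrete_subset[OF Delta sys small A(1) \<open>countable A\<close> A(2)])
  have injX: "inj_on g X" and gX: "g ` X = X" using g by (auto simp: bij_betw_def)
  have gD1: "infinite (g ` D1)" "countable (g ` D1)" "g ` D1 \<subseteq> X"
  proof -
    have "inj_on g D1" using injX by (rule inj_on_subset) (use D1(1) A(2) in blast)
    then show "infinite (g ` D1)" using D1(2) finite_imageD by blast
    show "countable (g ` D1)" using \<open>countable A\<close> D1(1) countable_subset by blast
    show "g ` D1 \<subseteq> X" using gX D1(1) A(2) by blast
  qed
  obtain D2 where D2: "D2 \<subseteq> g ` D1" "infinite D2"
    "\<forall>R\<in>\<R>. finite {x \<in> D2. \<exists>y\<in>D2. y \<noteq> x \<and> (x, y) \<in> R}"
    by (rule ex_infinite_discrete_subset[OF Delta sys small gD1])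
  define D where "D = {x \<in> D1. g x \<in> D2}"
  have gD: "g ` D = D2" using D2(1) by (auto simp: D_def)
  have DA: "D \<subseteq> A" using D1(1) by (auto simp: D_def)
  show ?thesis
  proof
    show "D \<subseteq> X" using DA A(2) by blast
    show "infinite D" using D2(2) gD by (metis finite_imageI)
    show "D \<inter> g ` D = {}"
    proof (rule ccontr)
      assume "D \<inter> g ` D \<noteq> {}"
      then obtain y where "y \<in> A" "g y \<in> A" using DA by blast
      then show False using apart[of "g y" y] \<open>0 < \<epsilon>\<close> by simp
    qed
    show "\<forall>x\<in>D. \<epsilon> \<le> dist (\<phi> (g x)) (\<phi> x)" using A(3) DA by blast
    show "\<forall>R\<in>\<R>. finite {z \<in> D \<union> g ` D. \<exists>y\<in>D \<union> g ` D. y \<noteq> z \<and> (z, y) \<in> R}"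
    proof
      fix R assume R: "R \<in> \<R>"
      have R_sym: "(y, x) \<in> R" if "(x, y) \<in> R" for x y
        using unif_finite_equivD(3)[OF finitary_system_member[OF sys R]] that .
      let ?F1 = "{x \<in> D1. \<exists>y\<in>D1. y \<noteq> x \<and> (x, y) \<in> R}"
      let ?F2 = "{x \<in> D2. \<exists>y\<in>D2. y \<noteq> x \<and> (x, y) \<in> R}"
      let ?F3 = "{x. \<exists>y. (x, y) \<in> R \<and> \<epsilon> / 2 \<le> dist (\<phi> x) (\<phi> y)}"
      have "{z \<in> D \<union> g ` D. \<exists>y\<in>D \<union> g ` D. y \<noteq> z \<and> (z, y) \<in> R} \<subseteq> ?F1 \<union> ?F2 \<union> ?F3"
      proof
        fix z assume "z \<in> {z \<in> D \<union> g ` D. \<exists>y\<in>D \<union> g ` D. y \<noteq> z \<and> (z, y) \<in> R}"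
        then obtain y where zy: "z \<in> D \<union> g ` D" "y \<in> D \<union> g ` D" "y \<noteq> z" "(z, y) \<in> R" by blast
        consider "z \<in> D" "y \<in> D" | "z \<in> D2" "y \<in> D2" | "z \<in> D" "y \<in> g ` D" | "z \<in> g ` D" "y \<in> D"
          using zy gD by blast
        then show "z \<in> ?F1 \<union> ?F2 \<union> ?F3"
        proof cases
          case 1 then show ?thesis using zy by (auto simp: D_def)
        next
          case 2 then show ?thesis using zy by blast
        next
          case 3 then show ?thesis using zy apart DA by blast
        next
          case 4
          then have "\<epsilon> / 2 \<le> dist (\<phi> y) (\<phi> z)" using apart DA by blast
          then show ?thesis using zy by (auto simp: dist_commute)
        qed
      qed
      moreover have "finite ?F3" using tame[OF R] \<open>0 < \<epsilon>\<close> by (intro tameD) simp_all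
      ultimately show "finite {z \<in> D \<union> g ` D. \<exists>y\<in>D \<union> g ` D. y \<noteq> z \<and> (z, y) \<in> R}"
        using bspec[OF D1(3) R] bspec[OF D2(3) R] by (meson finite_UnI finite_subset)
    qed
  qed
qed

text \<open>Softness provides the homeomorphism \<open>g\<close>, and \<open>S\<close> swaps \<open>x\<close> with \<open>g x\<close> for \<open>x\<close> in the thinned
set. All functions that extend to \<open>K\<close> tolerate \<open>S\<close> because \<open>g\<close> fixes the remainder.\<close>

lemma ex_separating_matching:
  fixes K :: "'k topology" and \<phi> :: "'k \<Rightarrow> 'm::metric_space"
  assumes M: "proper_space TYPE('m)" and Delta: "Delta_cell_is |UNIV :: real set|"
    and K: "compactification K" "separable_space K" "M_soft TYPE('m) K"
    and \<phi>: "\<phi> \<in> extensional (isolated_points K)" "bounded (\<phi> ` isolated_points K)"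
      "\<phi> \<notin> uc (isolated_points K) id K"
    and sys: "finitary_system (isolated_points K) \<R>" and small: "|\<R>| <o |UNIV :: real set|"
    and tame: "\<And>R. R \<in> \<R> \<Longrightarrow> tame R \<phi>"
  obtains S where "sym S" "single_valued S" "S \<subseteq> isolated_points K \<times> isolated_points K"
    "\<forall>f\<in>(uc (isolated_points K) id K :: ('k \<Rightarrow> 'm) set). tame S f" "\<not> tame S \<phi>"
    "\<forall>R\<in>\<R>. finite {z \<in> Domain S. \<exists>y\<in>Domain S. y \<noteq> z \<and> (z, y) \<in> R}"
proof -
  let ?X = "isolated_points K"
  have comp: "compact_space K" and dense: "K closure_of ?X = topspace K"
    using K(1) by (auto simp: compactification_def)
  have "\<exists>z\<in>topspace K. \<not> osc K \<phi> z \<le> 0"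
    using zero_osc_imp_uc[OF M dense \<phi>(1,2)] \<phi>(3) by blast
  then have "{z \<in> topspace K. osc K \<phi> z > 0} \<noteq> {}" by (auto simp: not_le)
  then obtain g \<epsilon> where g: "g \<in> homeo_fixing_remainder K" and eps: "0 < \<epsilon>"
    and far: "infinite {x \<in> ?X. \<epsilon> \<le> dist (\<phi> (g x)) (\<phi> x)}"
    using K(3)[unfolded M_soft_def, THEN spec, of \<phi>] \<phi>(2) by meson
  have bij: "bij_betw g ?X ?X" using g by (rule homeo_fixing_remainder_bij_betw)
  have injX: "inj_on g ?X" and gX: "g ` ?X = ?X" using bij by (auto simp: bij_betw_def)
  obtain D where D: "D \<subseteq> ?X" "infinite D" "D \<inter> g ` D = {}"
    "\<forall>x\<in>D. \<epsilon> \<le> dist (\<phi> (g x)) (\<phi> x)"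
    "\<forall>R\<in>\<R>. finite {z \<in> D \<union> g ` D. \<exists>y\<in>D \<union> g ` D. y \<noteq> z \<and> (z, y) \<in> R}"
    by (rule ex_sparse_matching[OF M Delta sys small countable_isolated_points[OF K(2)] bij \<phi>(2) tame eps far])
  define S where "S = (\<lambda>x. (x, g x)) ` D \<union> (\<lambda>x. (g x, x)) ` D"
  have dom: "Domain S = D \<union> g ` D" by (auto simp: S_def)
  have injD: "inj_on g D" using injX D(1) by (rule inj_on_subset)
  show ?thesis
  proof
    show "sym S" by (auto simp: S_def sym_def)
    show "single_valued S"
    proof (rule single_valuedI)
      fix x y z assume "(x, y) \<in> S" "(x, z) \<in> S"
      then show "y = z" using D(3) injD by (auto simp: S_def dest: inj_onD)
    qed
    show "S \<subseteq> ?X \<times> ?X" using D(1) gX by (auto simp: S_def)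
    show "\<forall>f\<in>(uc ?X id K :: ('k \<Rightarrow> 'm) set). tame S f"
      unfolding tame_def
    proof (intro ballI allI impI)
      fix f :: "'k \<Rightarrow> 'm" and \<delta> :: real assume f: "f \<in> uc ?X id K" and "0 < \<delta>"
      let ?F = "{x \<in> ?X. \<delta> \<le> dist (f x) (f (g x))}"
      have "{x. \<exists>y. (x, y) \<in> S \<and> \<delta> \<le> dist (f x) (f y)} \<subseteq> ?F \<union> g ` ?F"
        using D(1) by (auto simp: S_def dist_commute)
      moreover have "finite ?F" using comp f g \<open>0 < \<delta>\<close> by (rule uc_asymptotically_fixed)
      ultimately show "finite {x. \<exists>y. (x, y) \<in> S \<and> \<delta> \<le> dist (f x) (f y)}"
        by (meson finite_UnI finite_imageI finite_subset)
    qed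
    have "D \<subseteq> {x. \<exists>y. (x, y) \<in> S \<and> \<epsilon> \<le> dist (\<phi> x) (\<phi> y)}"
      using D(4) by (auto simp: S_def dist_commute)
    then show "\<not> tame S \<phi>" using D(2) eps tameD[of S \<phi> \<epsilon>] finite_subset by blast
    show "\<forall>R\<in>\<R>. finite {z \<in> Domain S. \<exists>y\<in>Domain S. y \<noteq> z \<and> (z, y) \<in> R}"
      unfolding dom by (rule D(5))
  qed
qed

section \<open>Transfinite recursion over all functions that do not extend\<close>

definition join :: "'x set \<Rightarrow> ('x \<times> 'x) set set \<Rightarrow> ('x \<times> 'x) set" where
  "join X \<T> = (Id_on X \<union> \<Union>\<T>)\<^sup>+"

lemma join_insert: "join X (insert S \<T>) = (join X \<T> \<union> S)\<^sup>+"
proof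
  let ?G = "Id_on X \<union> \<Union>\<T>"
  have "Id_on X \<union> \<Union>(insert S \<T>) \<subseteq> ?G\<^sup>+ \<union> S" by auto
  then show "join X (insert S \<T>) \<subseteq> (join X \<T> \<union> S)\<^sup>+"
    unfolding join_def by (rule trancl_mono_subset)
  have "?G\<^sup>+ \<subseteq> (Id_on X \<union> \<Union>(insert S \<T>))\<^sup>+" by (rule trancl_mono_subset) auto
  moreover have "S \<subseteq> (Id_on X \<union> \<Union>(insert S \<T>))\<^sup>+" by auto
  ultimately have "?G\<^sup>+ \<union> S \<subseteq> (Id_on X \<union> \<Union>(insert S \<T>))\<^sup>+" by simp
  then have "(?G\<^sup>+ \<union> S)\<^sup>+ \<subseteq> ((Id_on X \<union> \<Union>(insert S \<T>))\<^sup>+)\<^sup>+" by (rule trancl_mono_subset)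
  then show "(join X \<T> \<union> S)\<^sup>+ \<subseteq> join X (insert S \<T>)" by (simp add: join_def)
qed

lemma join_mono: "\<T> \<subseteq> \<T>' \<Longrightarrow> join X \<T> \<subseteq> join X \<T>'"
  unfolding join_def by (intro trancl_mono_subset) auto

lemma join_empty: "join X {} = Id_on X"
  unfolding join_def by (simp add: trancl_id trans_Id_on)

lemma subset_join: "S \<in> \<T> \<Longrightarrow> S \<subseteq> join X \<T>"
  unfolding join_def by (auto intro: r_into_trancl)

lemma tame_mono: "R \<subseteq> S \<Longrightarrow> tame S f \<Longrightarrow> tame R f"
  unfolding tame_def
proof (intro allI impI)
  fix \<epsilon> :: real assume RS: "R \<subseteq> S" and "0 < \<epsilon>"
    and tame: "\<forall>\<epsilon>>0. finite {x. \<exists>y. (x, y) \<in> S \<and> \<epsilon> \<le> dist (f x) (f y)}"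
  have "{x. \<exists>y. (x, y) \<in> R \<and> \<epsilon> \<le> dist (f x) (f y)} \<subseteq> {x. \<exists>y. (x, y) \<in> S \<and> \<epsilon> \<le> dist (f x) (f y)}"
    using RS by blast
  then show "finite {x. \<exists>y. (x, y) \<in> R \<and> \<epsilon> \<le> dist (f x) (f y)}"
    using tame \<open>0 < \<epsilon>\<close> by (simp add: finite_subset)
qed

definition admissible :: "'x set \<Rightarrow> ('x \<Rightarrow> 'm::metric_space) set \<Rightarrow> ('x \<times> 'x) set \<Rightarrow> bool" where
  "admissible X U R \<longleftrightarrow> unif_finite_equiv X R \<and> (\<forall>f\<in>U. tame R f)"

lemma admissible_Id_on: "admissible X U (Id_on X)"
proof -
  have "Id_on X `` {x} = {x}" if "x \<in> X" for x using that by auto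
  then have "unif_finite_equiv X (Id_on X)"
    unfolding unif_finite_equiv_def
    by (auto intro!: equivI exI[of _ "1::nat"] simp: refl_on_def sym_def trans_def)
  moreover have "tame (Id_on X) f" for f :: "'a \<Rightarrow> 'b"
  proof -
    have "{x. \<exists>y. (x, y) \<in> Id_on X \<and> \<epsilon> \<le> dist (f x) (f y)} = {}" if "0 < \<epsilon>" for \<epsilon>
      using that by auto
    then show ?thesis unfolding tame_def by (metis (no_types, lifting) finite.emptyI)
  qed
  ultimately show ?thesis by (simp add: admissible_def)
qed

text \<open>The chosen relations are matchings, in general neither transitive nor directed by inclusion.
Their finite joins are both, and so can serve as generators of a coarse structure.\<close>

definition finite_joins :: "'x set \<Rightarrow> ('i \<Rightarrow> ('x \<times> 'x) set) \<Rightarrow> 'i set \<Rightarrow> ('x \<times> 'x) set set" where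
  "finite_joins X S I = (\<lambda>T. join X (S ` T)) ` {T. finite T \<and> T \<subseteq> I}"

lemma finitary_system_finite_joins:
  assumes "\<And>R. R \<in> finite_joins X S I \<Longrightarrow> unif_finite_equiv X R"
  shows "finitary_system X (finite_joins X S I)"
  unfolding finitary_system_def
proof (intro conjI ballI)
  show "finite_joins X S I \<noteq> {}" by (auto simp: finite_joins_def)
  show "unif_finite_equiv X R" if "R \<in> finite_joins X S I" for R using assms that .
  fix R R' assume "R \<in> finite_joins X S I" "R' \<in> finite_joins X S I"
  then obtain T T' where T: "finite T" "T \<subseteq> I" "R = join X (S ` T)"
    "finite T'" "T' \<subseteq> I" "R' = join X (S ` T')" unfolding finite_joins_def by auto
  have "R \<union> R' \<subseteq> join X (S ` (T \<union> T'))"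
    unfolding T by (intro Un_least join_mono image_mono) auto
  moreover have "join X (S ` (T \<union> T')) \<in> finite_joins X S I"
    using T unfolding finite_joins_def by blast
  ultimately show "\<exists>T\<in>finite_joins X S I. R \<union> R' \<subseteq> T" by blast
qed

lemma finite_has_maximum_in_well_order:
  assumes r: "Well_order r" and T: "finite T" "T \<noteq> {}" "T \<subseteq> Field r"
  shows "\<exists>m\<in>T. T - {m} \<subseteq> underS r m"
  using T
proof (induction T rule: finite_ne_induct)
  case (insert a T)
  then obtain m where m: "m \<in> T" "T - {m} \<subseteq> underS r m" by auto
  have tot: "total_on (Field r) r" and tr: "trans r"
    using r by (auto simp: well_order_on_def linear_order_on_def partial_order_on_def preorder_on_def)
  have am: "a \<noteq> m" using insert m(1) by blast
  have asym: "antisym r"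
    using r by (auto simp: well_order_on_def linear_order_on_def partial_order_on_def)
  show ?case
  proof (cases "(a, m) \<in> r")
    case True
    then show ?thesis using m am by (intro bexI[of _ m]) (auto simp: underS_def)
  next
    case False
    then have ma: "(m, a) \<in> r"
      using tot am insert.prems m(1) unfolding total_on_def by blast
    have "t \<in> underS r a" if "t \<in> T" for t
    proof -
      have "(t, m) \<in> r \<or> t = m" using m(2) that by (auto simp: underS_def)
      then have "(t, a) \<in> r" using ma tr by (auto dest: transD)
      then show ?thesis using insert.hyps(3) that by (auto simp: underS_def)
    qed
    then show ?thesis by blast
  qed
qed auto

text \<open>Limit stages need no argument: a finite join involves a last chosen relation \<open>S m\<close>, and the choice
of \<open>S m\<close> already guaranteed the admissibility of its joins with finitely many earlier ones.\<close>

lemma admissible_finite_joins: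
  assumes r: "Well_order r" and I: "I \<subseteq> Field r"
    and step: "\<And>\<psi> T. \<psi> \<in> I \<Longrightarrow> finite T \<Longrightarrow> T \<subseteq> underS r \<psi> \<Longrightarrow> admissible X U (join X (insert (S \<psi>) (S ` T)))"
    and R: "R \<in> finite_joins X S I"
  shows "admissible X U R"
proof -
  obtain T where T: "finite T" "T \<subseteq> I" "R = join X (S ` T)" using R unfolding finite_joins_def by auto
  show ?thesis
  proof (cases "T = {}")
    case True
    then show ?thesis by (simp add: T(3) join_empty admissible_Id_on)
  next
    case False
    then obtain m where m: "m \<in> T" "T - {m} \<subseteq> underS r m"
      using finite_has_maximum_in_well_order[OF r T(1)] T(2) I by blast
    have "S ` T = insert (S m) (S ` (T - {m}))" using m(1) by blast
    then show ?thesis using step[of m "T - {m}"] m T by auto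
  qed
qed

text \<open>If \<open>\<phi>\<close> violates slow oscillation already, the empty relation will do. Otherwise the finite joins
are fewer than continuum many and all tame for \<open>\<phi>\<close>, so a matching that separates \<open>\<phi>\<close> exists.\<close>

lemma ex_next_relation:
  fixes K :: "'k topology" and \<phi> :: "'k \<Rightarrow> 'm::metric_space"
  defines "X \<equiv> isolated_points K"
  defines "U \<equiv> (uc X id K :: ('k \<Rightarrow> 'm) set)"
  assumes M: "proper_space TYPE('m)" and Delta: "Delta_cell_is |UNIV :: real set|"
    and K: "compactification K" "separable_space K" "M_soft TYPE('m) K"
    and \<phi>: "\<phi> \<in> extensional X" "bounded (\<phi> ` X)" "\<phi> \<notin> U"
    and I: "|I| <o |UNIV :: real set|" and adm: "\<And>R. R \<in> finite_joins X S I \<Longrightarrow> admissible X U R"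
  shows "\<exists>s. (\<forall>T. finite T \<and> T \<subseteq> I \<longrightarrow> admissible X U (join X (insert s (S ` T)))) \<and>
             (\<exists>T. finite T \<and> T \<subseteq> I \<and> \<not> tame (join X (insert s (S ` T))) \<phi>)"
proof (cases "\<exists>R\<in>finite_joins X S I. \<not> tame R \<phi>")
  case True
  have "join X (insert {} \<T>) = join X \<T>" for \<T> by (simp add: join_def)
  then show ?thesis using True adm unfolding finite_joins_def by (intro exI[of _ "{}"]) auto
next
  case False
  have sys: "finitary_system X (finite_joins X S I)"
    using adm by (intro finitary_system_finite_joins) (simp add: admissible_def)
  have small: "|finite_joins X S I| <o |UNIV :: real set|"
    unfolding finite_joins_def
    using card_of_image finite_subsets_ordLess_real[OF I] by (rule ordLeq_ordLess_trans)
  obtain s where s: "sym s" "single_valued s" "s \<subseteq> X \<times> X" "\<forall>f\<in>U. tame s f" "\<not> tame s \<phi>"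
    "\<forall>R\<in>finite_joins X S I. finite {z \<in> Domain s. \<exists>y\<in>Domain s. y \<noteq> z \<and> (z, y) \<in> R}"
    using False unfolding X_def U_def
    by (elim ex_separating_matching[OF M Delta K \<phi>[unfolded X_def U_def] sys[unfolded X_def] small[unfolded X_def], rotated])
      blast
  have "admissible X U (join X (insert s (S ` T)))" if T: "finite T" "T \<subseteq> I" for T
  proof -
    have R: "join X (S ` T) \<in> finite_joins X S I" using T unfolding finite_joins_def by blast
    then have "unif_finite_equiv X (join X (S ` T))" "\<And>f. f \<in> U \<Longrightarrow> tame (join X (S ` T)) f"
      using adm by (auto simp: admissible_def)
    then show ?thesis
      unfolding admissible_def join_insert using adjoin_matching[OF _ s(1-3) bspec[OF s(6) R]] s(4) by blast
  qed
  moreover have "\<not> tame (join X (insert s (S ` {}))) \<phi>"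
    using s(5) tame_mono[OF subset_join[of s "insert s (S ` {})" X]] by blast
  ultimately show ?thesis by (meson empty_subsetI finite.emptyI)
qed

text \<open>The bounded functions that do not extend are well-ordered by a cardinal well-order. Their number
is at most the continuum, so each has fewer than continuum many predecessors, which is what
the choice at its stage requires.\<close>

lemma ex_system_detecting_uc:
  fixes K :: "'k topology"
  defines "X \<equiv> isolated_points K"
  defines "U \<equiv> (uc X id K :: ('k \<Rightarrow> 'm::metric_space) set)"
  assumes M: "proper_space TYPE('m)" and Delta: "Delta_cell_is |UNIV :: real set|"
    and K: "compactification K" "separable_space K" "M_soft TYPE('m) K"
  obtains \<R> where "finitary_system X \<R>" "\<forall>R\<in>\<R>. \<forall>f\<in>U. tame R f"
    "\<forall>f :: 'k \<Rightarrow> 'm. f \<in> extensional X \<and> bounded (f ` X) \<and> f \<notin> U \<longrightarrow> (\<exists>R\<in>\<R>. \<not> tame R f)"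
proof -
  define \<Phi> where "\<Phi> = {\<phi> :: 'k \<Rightarrow> 'm. \<phi> \<in> extensional X \<and> bounded (\<phi> ` X) \<and> \<phi> \<notin> U}"
  let ?r = "|\<Phi>|"
  have r: "Well_order ?r" by (rule card_of_Well_order)
  have Field_r: "Field ?r = \<Phi>" by (rule Field_card_of)
  have "|\<Phi>| \<le>o |extensional X :: ('k \<Rightarrow> 'm) set|"
    by (rule card_of_mono1) (auto simp: \<Phi>_def)
  also have "|extensional X :: ('k \<Rightarrow> 'm) set| \<le>o |UNIV :: real set|"
    using M countable_isolated_points[OF K(2)] unfolding X_def by (rule card_of_functions_ordLeq_real)
  finally have \<Phi>_le: "|\<Phi>| \<le>o |UNIV :: real set|" .
  have below: "underS ?r \<phi> \<subseteq> \<Phi>" for \<phi>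
  proof -
    have "underS ?r \<phi> \<subseteq> Field ?r" by (auto simp: underS_def Field_def)
    then show ?thesis by (simp only: Field_r)
  qed
  have small: "|underS ?r \<phi>| <o |UNIV :: real set|" if "\<phi> \<in> \<Phi>" for \<phi>
  proof -
    have "\<phi> \<in> Field ?r" using that by (simp only: Field_r)
    then have "|underS ?r \<phi>| <o |\<Phi>|" by (rule card_of_underS[OF card_of_Card_order])
    then show ?thesis using \<Phi>_le by (rule ordLess_ordLeq_trans)
  qed
  \<comment> \<open>\<open>P S \<phi> s\<close>: given the relations \<open>S\<close> chosen below \<open>\<phi>\<close>, the relation \<open>s\<close> is a legitimate choice at \<open>\<phi>\<close>.\<close>
  define P where "P S \<phi> s \<longleftrightarrow> (\<phi> \<in> \<Phi> \<longrightarrow>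
      (\<forall>T. finite T \<and> T \<subseteq> underS ?r \<phi> \<longrightarrow> admissible X U (join X (insert s (S ` T)))) \<and>
      (\<exists>T. finite T \<and> T \<subseteq> underS ?r \<phi> \<and> \<not> tame (join X (insert s (S ` T))) \<phi>))" for S \<phi> s
  have "\<exists>S. \<forall>\<phi>. P S \<phi> (S \<phi>)"
  proof (rule dependent_wf_choice)
    show "wf (?r - Id)" using r by (simp add: well_order_on_def)
  next
    fix S S' :: "('k \<Rightarrow> 'm) \<Rightarrow> ('k \<times> 'k) set" and \<phi> s
    assume eq: "\<And>\<psi>. (\<psi>, \<phi>) \<in> ?r - Id \<Longrightarrow> S \<psi> = S' \<psi>"
    have "S ` T = S' ` T" if "T \<subseteq> underS ?r \<phi>" for T
      using that eq by (intro image_cong) (auto simp: underS_def)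
    then show "P S \<phi> s = P S' \<phi> s" unfolding P_def by (metis (no_types, lifting))
  next
    fix \<phi> and S :: "('k \<Rightarrow> 'm) \<Rightarrow> ('k \<times> 'k) set"
    assume IH: "\<And>\<psi>. (\<psi>, \<phi>) \<in> ?r - Id \<Longrightarrow> P S \<psi> (S \<psi>)"
    show "\<exists>s. P S \<phi> s"
    proof (cases "\<phi> \<in> \<Phi>")
      case True
      have "admissible X U R" if "R \<in> finite_joins X S (underS ?r \<phi>)" for R
      proof (rule admissible_finite_joins[OF r _ _ that])
        show "underS ?r \<phi> \<subseteq> Field ?r" by (auto simp: underS_def Field_def)
        fix \<psi> T assume "\<psi> \<in> underS ?r \<phi>" "finite T" "T \<subseteq> underS ?r \<psi>"
        moreover have "P S \<psi> (S \<psi>)" using IH \<open>\<psi> \<in> underS ?r \<phi>\<close> by (auto simp: underS_def)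
        ultimately show "admissible X U (join X (insert (S \<psi>) (S ` T)))"
          using below unfolding P_def by blast
      qed
      then show ?thesis
        unfolding P_def using ex_next_relation[OF M Delta K _ _ _ small[OF True], of \<phi> S] True
        by (simp add: \<Phi>_def X_def U_def)
    qed (simp add: P_def)
  qed
  then obtain S where S: "\<And>\<phi>. P S \<phi> (S \<phi>)" by blast
  have adm: "admissible X U R" if "R \<in> finite_joins X S \<Phi>" for R
  proof (rule admissible_finite_joins[OF r _ _ that])
    show "admissible X U (join X (insert (S \<psi>) (S ` T)))"
      if "\<psi> \<in> \<Phi>" "finite T" "T \<subseteq> underS ?r \<psi>" for \<psi> T
      using S[of \<psi>] that unfolding P_def by blast
  qed (simp add: Field_r)
  show ?thesis
  proof
    show "finitary_system X (finite_joins X S \<Phi>)"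
      using adm by (intro finitary_system_finite_joins) (simp add: admissible_def)
    show "\<forall>R\<in>finite_joins X S \<Phi>. \<forall>f\<in>U. tame R f"
      using adm by (simp add: admissible_def)
    show "\<forall>f. f \<in> extensional X \<and> bounded (f ` X) \<and> f \<notin> U \<longrightarrow> (\<exists>R\<in>finite_joins X S \<Phi>. \<not> tame R f)"
    proof (intro allI impI)
      fix f :: "'k \<Rightarrow> 'm" assume "f \<in> extensional X \<and> bounded (f ` X) \<and> f \<notin> U"
      then have f: "f \<in> \<Phi>" by (simp add: \<Phi>_def)
      then obtain T where T: "finite T" "T \<subseteq> underS ?r f" "\<not> tame (join X (insert (S f) (S ` T))) f"
        using S[of f] unfolding P_def by blast
      have "join X (S ` insert f T) \<in> finite_joins X S \<Phi>"
        unfolding finite_joins_def using T(1,2) f below by (intro imageI) blast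
      moreover have "\<not> tame (join X (S ` insert f T)) f" using T(3) by simp
      ultimately show "\<exists>R\<in>finite_joins X S \<Phi>. \<not> tame R f" by blast
    qed
  qed
qed

lemma uc_empty: "uc {} e K = {\<lambda>_. undefined}"
  by (auto simp: uc_def intro!: exI[of _ "\<lambda>_. undefined"])

lemma M_equivalent_empty:
  assumes K: "compactification K" "isolated_points K = {}"
  shows "M_equivalent TYPE('m::metric_space) (isolated_points K) id K
     (so_embed (isolated_points K) \<E> :: 'k \<Rightarrow> ('k \<Rightarrow> 'm) \<Rightarrow> 'm)
     (M_compactification (isolated_points K) \<E>)"
proof -
  let ?L = "M_compactification {} \<E> :: (('k \<Rightarrow> 'm) \<Rightarrow> 'm) topology"
  have "topspace ?L = {}" by (simp add: M_compactification_def)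
  then have L: "?L = trivial_topology" by simp
  then have iso: "isolated_points ?L = {}" by (simp add: isolated_points_def)
  have "compactification ?L"
    unfolding compactification_def iso by (simp add: L Hausdorff_space_def)
  then show ?thesis using K iso by (simp add: M_equivalent_def uc_empty bij_betw_def)
qed

section \<open>The coarse structure of a soft compactification\<close>

theorem theorem6p5:
  fixes K :: "'k topology"
  assumes "proper_space TYPE('m::metric_space)"
    and "Delta_cell_is |UNIV :: real set|"
    and "compactification K"
    and "separable_space K"
    and "M_soft TYPE('m) K"
  shows "\<exists>\<E>. coarse_structure (isolated_points K) \<E> \<and>
              cellular (isolated_points K) \<E> \<and>
              finitary (isolated_points K) \<E> \<and>
              M_equivalent TYPE('m) (isolated_points K)
                id K
                (so_embed (isolated_points K) \<E> :: 'k \<Rightarrow> ('k \<Rightarrow> 'm) \<Rightarrow> 'm)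
                (M_compactification (isolated_points K) \<E>)"
proof -
  let ?X = "isolated_points K"
  obtain \<R> where sys: "finitary_system ?X \<R>"
    and tame: "\<forall>R\<in>\<R>. \<forall>f\<in>(uc ?X id K :: ('k \<Rightarrow> 'm) set). tame R f"
    and wild: "\<forall>f :: 'k \<Rightarrow> 'm. f \<in> extensional ?X \<and> bounded (f ` ?X) \<and> f \<notin> uc ?X id K
      \<longrightarrow> (\<exists>R\<in>\<R>. \<not> tame R f)"
    by (rule ex_system_detecting_uc[OF assms])
  let ?\<E> = "generated_coarse ?X \<R>"
  have "M_equivalent TYPE('m) ?X id K (so_embed ?X ?\<E> :: 'k \<Rightarrow> ('k \<Rightarrow> 'm) \<Rightarrow> 'm)
      (M_compactification ?X ?\<E>)"
  proof (cases "?X = {}")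
    case True
    then show ?thesis by (rule M_equivalent_empty[OF assms(3)])
  next
    case False
    have "compact_space K" using assms(3) by (simp add: compactification_def)
    have so_iff: "f \<in> so ?X ?\<E> \<longleftrightarrow> f \<in> extensional ?X \<and> bounded (f ` ?X) \<and> (\<forall>R\<in>\<R>. tame R f)"
      for f :: "'k \<Rightarrow> 'm"
      using slowly_oscillating_generated_coarse_iff[OF sys False, of f] by (simp add: so_def)
    have "(so ?X ?\<E> :: ('k \<Rightarrow> 'm) set) = uc ?X id K"
    proof (intro set_eqI iffI)
      show "f \<in> uc ?X id K" if "f \<in> so ?X ?\<E>" for f :: "'k \<Rightarrow> 'm"
        using that wild unfolding so_iff by blast
      show "f \<in> so ?X ?\<E>" if "f \<in> uc ?X id K" for f :: "'k \<Rightarrow> 'm"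
      proof -
        have "f \<in> extensional ?X" using that by (auto simp: uc_def)
        then show ?thesis
          unfolding so_iff using uc_bounded[OF \<open>compact_space K\<close> that] tame that by blast
      qed
    qed
    then show ?thesis by (rule M_equivalent_if_so_eq_uc[OF assms(1,3)])
  qed
  then show ?thesis
    using coarse_structure_generated_coarse[OF sys] cellular_generated_coarse[OF sys]
      finitary_generated_coarse[OF sys] by blast
qed

end
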